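(* For every $\varepsilon>0$ there exist $\delta=\delta(\varepsilon)>0$ and $N=N(\varepsilon)$ such that the following holds for every $n\ge N$. Let $G$ be a graph on a vertex set $V$ with a partition $V=V_1\cup V_2\cup V_3$. Suppose that $G$ is locally maximal, $\max_{i\in[3]}\big||V_i|-n\big|\le\delta n$, and $\rho_3(G)\le\delta$. Then $\|G\|_2\le 9n^3+\varepsilon n^3$.
   Context: Indices are taken modulo $3$. For a graph $G$, $\|G\|_2=\sum_{v\in V} d_G(v)^2$. $|G|$ denotes the number of edges; $G[S]$ is the induced subgraph on $S$, and $G[S_a,S_b]$ is the bipartite subgraph of edges of $G$ between disjoint sets $S_a$ and $S_b$. $G$ is locally maximal (with respect to the partition) if there exists $i\in[3]$ such that (i) $|G[V_i,V_{i+1}]|+|G[V_{i+2}]|\ge|G[V_i,V_{i+2}]|+|G[V_i]|$ and (ii) $|G[V_{i+1},V_{i+2}]|+|G[V_{i+2}]|\ge|G[V_i,V_{i+2}]|+|G[V_{i+1}]|$. A $3$-set $\{u,v,w\}$ is a triangle of type $V_iV_jV_k$ if it spans a triangle in $G$ and $(u,v,w)\in V_i\times V_j\times V_k$; $\rho_3(G)$ is the probability that a uniformly random $3$-subset of $V$ spans a triangle of one of the types $V_1V_2V_3$, $V_1V_1V_2$, $V_2V_2V_3$, $V_3V_3V_1$. *)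

theory Defs
  imports "HOL-Probability.Probability" "HOL-Library.Ramsey" "HOL-Library.Numeral_Type"
begin

definition simple_graph :: "'a set \<Rightarrow> 'a set set \<Rightarrow> bool" where
  "simple_graph V E \<longleftrightarrow> finite V \<and> E \<subseteq> nsets V 2"

definition vertex_degree :: "'a set set \<Rightarrow> 'a \<Rightarrow> nat" where
  "vertex_degree E v = card {e \<in> E. v \<in> e}"

definition l2_norm :: "'a set \<Rightarrow> 'a set set \<Rightarrow> nat" where
  "l2_norm V E = (\<Sum>v\<in>V. (vertex_degree E v)\<^sup>2)"

definition induced_edges :: "'a set set \<Rightarrow> 'a set \<Rightarrow> 'a set set" where
  "induced_edges E S = {e \<in> E. e \<subseteq> S}"

definition edges_between :: "'a set set \<Rightarrow> 'a set \<Rightarrow> 'a set \<Rightarrow> 'a set set" where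
  "edges_between E S T = {e \<in> E. \<exists>s\<in>S. \<exists>t\<in>T. e = {s, t}}"

text \<open>Parts are indexed by the three-element type \<open>3\<close>, whose arithmetic is modulo 3: the
  indices are \<open>1\<close>, \<open>2\<close> and \<open>3\<close> (with \<open>3 = 0\<close>), and \<open>i + 1\<close>, \<open>i + 2\<close> wrap around.
  Parts are not required to be nonempty.\<close>

definition tripartition :: "'a set \<Rightarrow> (3 \<Rightarrow> 'a set) \<Rightarrow> bool" where
  "tripartition V P \<longleftrightarrow> (\<Union>i. P i) = V \<and> disjoint_family P"

definition locally_maximal :: "(3 \<Rightarrow> 'a set) \<Rightarrow> 'a set set \<Rightarrow> bool" where
  "locally_maximal P E \<longleftrightarrow>
    (\<exists>i. card (edges_between E (P i) (P (i + 1))) + card (induced_edges E (P (i + 2)))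
           \<ge> card (edges_between E (P i) (P (i + 2))) + card (induced_edges E (P i))
       \<and> card (edges_between E (P (i + 1)) (P (i + 2))) + card (induced_edges E (P (i + 2)))
           \<ge> card (edges_between E (P i) (P (i + 2))) + card (induced_edges E (P (i + 1))))"

definition triangle_of_type ::
    "(3 \<Rightarrow> 'a set) \<Rightarrow> 'a set set \<Rightarrow> 3 \<Rightarrow> 3 \<Rightarrow> 3 \<Rightarrow> 'a set \<Rightarrow> bool" where
  "triangle_of_type P E i j k T \<longleftrightarrow>
    card T = 3 \<and> nsets T 2 \<subseteq> E \<and> (\<exists>u\<in>P i. \<exists>v\<in>P j. \<exists>w\<in>P k. T = {u, v, w})"

text \<open>Only meaningful when \<open>V\<close> is finite with at least three elements; otherwise
  \<open>pmf_of_set\<close> is unspecified.\<close>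

definition rho3 :: "'a set \<Rightarrow> (3 \<Rightarrow> 'a set) \<Rightarrow> 'a set set \<Rightarrow> real" where
  "rho3 V P E = measure_pmf.prob (pmf_of_set (nsets V 3))
     {T. triangle_of_type P E 1 2 3 T \<or> triangle_of_type P E 1 1 2 T \<or>
         triangle_of_type P E 2 2 3 T \<or> triangle_of_type P E 3 3 1 T}"

end

theory Submission
  imports Defs
begin

text \<open>
  Sampling \<open>m\<close> random vertices from each part yields, with probability close to \<open>1\<close>, a graph without
  any triangle of the four types, and the normalised sum of squared degrees is preserved in
  expectation up to \<open>O(1/m)\<close>.  So it suffices to show \<open>\<Sum>v. x v * (d v)\<^sup>2 \<le> 9\<close> for weighted graphs that
  have no such triangle and whose parts have total weight \<open>1\<close>.

  The sum is a convex function of the weight moved between two nonadjacent vertices of one part, so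
  by Zykov symmetrisation the parts \<open>A\<close>, \<open>B\<close>, \<open>C\<close> may be assumed to be cliques.  Then every vertex has
  at most one neighbour in the preceding part: there are partial functions \<open>B \<rightarrow> A \<rightarrow> C \<rightarrow> B\<close> without
  3-cycles.  If a vertex of weight \<open>s\<close> has a target of weight \<open>u\<close> and receives arcs from mass \<open>I \<le> 1\<close>, its
  degree is \<open>1 - s + u + I\<close>; with \<open>I\<^sup>2 \<le> I\<close> the sum is at most \<open>3\<close> plus a sum of terms
  \<open>s * (u * (5 - 2 * s - u) - s * (2 - s))\<close> plus twice the expected number of pairs of arcs on a random
  triple.  As no triple carries three arcs, that number is bounded by linear combinations of the arc
  densities.  Not all three arcs between the heaviest vertices \<open>a\<close>, \<open>b\<close>, \<open>c\<close> are present.  If all are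
  missing the bound has slack; otherwise, up to rotation, \<open>b \<rightarrow> a\<close> is present and \<open>a \<rightarrow> c\<close> is missing,
  and it remains to bound a cubic in the three heaviest weights and the weights met on the walk
  \<open>a \<rightarrow> c' \<rightarrow> b' \<rightarrow> a'\<close>.
\<close>

section \<open>Polynomial inequalities\<close>

text \<open>
  With \<open>p\<close>, \<open>q\<close>, \<open>r\<close> the heaviest weights, \<open>core (1 - p) (1 - q) r\<close> is the part of the slack that does
  not involve the walk leaving the heaviest vertex of \<open>A\<close>; \<open>w\<close> and \<open>g\<close> are the weights of \<open>c'\<close> and
  \<open>b'\<close>.  The nonnegative combinations of products of the constraints below were found by linear
  programming.
\<close>

definition core :: "real \<Rightarrow> real \<Rightarrow> real \<Rightarrow> real" where
  "core x y r = x^3 + y^3 + 2 * y^2 + 4 * x * y - 2 * x * y^2 + r^2 * (4 + x - 2 * y - r)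
      - 7 * x * r"

text \<open>In the notation of \<open>one_missing_arc\<close> this is the slack for the triple
  \<open>(6, 6, 6)\<close> when \<open>1/2 \<le> p \<le> q\<close>, after discarding nonnegative
  terms with \<open>h\<close>.\<close>

lemma core_middle:
  fixes x y r w g :: real
  assumes "0 \<le> w" "0 \<le> g" "0 \<le> r - w" "0 \<le> 1 - r - w" "0 \<le> y - g"
      "0 \<le> x - y" "0 \<le> 1 - 2 * x"
  shows "0 \<le> core x y r + (x - y) + x * r + w * (1 - 4 * y - y^2 + 2 * x + 2 * x^2)
      - w * g * (6 - g - 2 * w) + w^2 * (3 - x - w) + g^2 * (2 - g)"
proof -
  have "core x y r + (x - y) + x * r + w * (1 - 4 * y - y^2 + 2 * x + 2 * x^2)
      - w * g * (6 - g - 2 * w) + w^2 * (3 - x - w) + g^2 * (2 - g) =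
      2 * w * (r - w) * (y - g) + 2/3 * (x - y) * (1 - 2 * x) * (1 - 2 * x)
      + 3 * w * w * (1 - r - w) + 5/2 * w * g * g + 5/4 * (1 - 2 * x) * (r - x)^2
      + 2 * g * g * (x - y) + (y - g) * (y - g) * (y - g) + 5/2 * w * w * w
      + (1 - r - w) * (y - g) * (x - y) + 6 * w * g * (y - g) + 2 * w * w * (y - g)
      + (1 - r - w) * (w - y)^2 + 3 * (y - g) * (w - g)^2
      + 1/6 * (1 - r - w) * (x - y) * (1 - 2 * x) + 37/6 * w * (y - g) * (x - y)
      + 10/3 * (x - y) * (r - x/2)^2 + 2 * w * g * (1 - r - w) + 9/8 * (1 - r - w) * (r - x)^2
      + 13/4 * w * (w - y)^2 + 4 * g * (y - g) * (x - y) + 13/4 * w * (r - w) * (1 - 2 * x)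
      + 1/2 * (r - w) * (x - y) * (1 - 2 * x) + 4 * w * w * (r - w)
      + 1/6 * (1 - r - w) * (1 - r - w) * (x - y) + g * (1 - r - w) * (x - y)
      + 3/2 * g * (r - x)^2 + 2 * (w - y)^2 + 2 * g * (x - y) * (x - y)
      + 2 * (y - g) * (x - y) * (x - y) + 37/6 * w * g * (x - y) + 2 * (1 - r - w) * (w - g)^2
      + 8/3 * w * (r - w) * (x - y) + 3 * w * (1 - r - w) * (x - y) + 3/2 * (y - g) * (r - x)^2
      + 4 * w * (1 - r - w) * (y - g) + 1/8 * (r - w) * (r - x)^2
      + w * (1 - r - w) * (1 - r - w) + 23/12 * w * (x - y) * (x - y) + 5/2 * w * (w - g)^2
      + 5/8 * (r - x)^2 + w * (r - w) * (r - w) + 3 * g * (y - g) * (y - g)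
      + 2 * (y - g) * (y - g) * (x - y) + (r - w) * (r - w) * (1 - 2 * x)
      + 2 * (r - w) * (w - g)^2 + 3/4 * w * (r - w) * (1 - r - w)"
    unfolding core_def by algebra
  also have "\<dots> \<ge> 0"
    using assms by (intro add_nonneg_nonneg mult_nonneg_nonneg zero_le_power2) auto
  finally show ?thesis .
qed

text \<open>Triple \<open>(5, 7, 7)\<close> with \<open>q \<le> p \<le> 1/2\<close>. Here
  \<open>h = p\<close> is possible, so the factor \<open>p - h\<close> gives nothing.\<close>

lemma core_left_high:
  fixes x y r w g :: real
  assumes "0 \<le> w" "0 \<le> g" "0 \<le> r - w" "0 \<le> 1 - r - w" "0 \<le> y - g"
      "0 \<le> 1 - y - g" "0 \<le> y - x" "0 \<le> 2 * x - 1" "0 \<le> 1 - y"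
  shows "0 \<le> core x y r + w * (1 - 5 * y - y^2 + 3 * x + 2 * x^2) - w * g * (7 - g - 2 * w)
      + w^2 * (3 - x - w) + g^2 * (2 - g)"
proof -
  have "core x y r + w * (1 - 5 * y - y^2 + 3 * x + 2 * x^2) - w * g * (7 - g - 2 * w)
      + w^2 * (3 - x - w) + g^2 * (2 - g) =
      w * (1 - r)^2 + 3/8 * w * (1 - r - w) * (y - x) + 11/2 * w * w * (2 * x - 1)
      + 13/16 * (r - w) * (2 * x - 1) * (2 * x - 1) + 45/8 * (1 - r - w) * (y - g) * (y - x)
      + 43/8 * w * (y - g) * (y - x) + 33/4 * g * (1 - r - w) * (y - x)
      + 4 * w * (y - x) * (2 * x - 1) + 3/16 * (r - w) * (1 - r - w) * (2 * x - 1)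
      + 5 * w * w * (1 - y - g) + 1/4 * (r - w) * (r - w) * (1 - y)
      + 13/16 * (1 - r - w) * (1 - y - g) * (2 * x - 1) + 1/4 * (1 - r - w) * (w - 2 * g)^2
      + 53/8 * g * (1 - r - w) * (2 * x - 1) + 7/2 * w * (r - w) * (1 - y - g)
      + (y - x) * (y - x) * (2 * x - 1) + (1 - y - g) * (y - x) * (2 * x - 1)
      + (1 - y - g) * (w - g)^2 + 3/16 * (2 * x - 1) * (2 * x - 1) * (2 * x - 1)
      + 25/16 * (r - w) * (1 - r - w) * (y - x) + 35/8 * w * g * (y - x)
      + 3/16 * (r - w) * (1 - r - w) * (1 - r - w)
      + 1/2 * (1 - y - g) * (1 - y - g) * (2 * x - 1) + 1/16 * w * w * (1 - r - w)
      + 11/8 * w * (y - x) * (1 - y) + 5/16 * (1 - r - w) * (2 * x - 1) * (2 * x - 1)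
      + 5/2 * w * (r - w) * (2 * x - 1) + 3/16 * (r - w) * (r - w) * (y - x) + (w - g)^2
      + 41/8 * (r - w) * (y - x) * (1 - y) + 25/8 * w * (2 * x - 1) * (2 * x - 1)
      + 69/16 * (1 - r - w) * (y - g) * (2 * x - 1) + 19/16 * (1 - r - w) * (1 - r)^2
      + 1/4 * (y - x) * (w - 2 * g)^2 + (y - x) * (y - x) * (y - x)
      + 77/16 * (r - w) * (y - x) * (2 * x - 1) + 3/8 * g * (1 - r - w) * (1 - r - w)
      + 23/8 * w * (1 - r - w) * (2 * x - 1) + 3/2 * g * (r - w) * (y - x)
      + 3/2 * g * (r - w) * (1 - y - g) + 9/4 * (r - w) * (1 - r - w) * (1 - y - g)
      + 1/2 * g * (1 - r - w) * (y - g) + 7/2 * w * (1 - r - w) * (1 - y - g)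
      + 5/2 * (1 - y - g) * (r - x)^2 + 1/8 * (r - w) * (r - w) * (1 - y - g)
      + 25/8 * (1 - r - w) * (1 - y - g) * (y - x) + 61/8 * (r - w) * (y - x) * (y - x)
      + 1/8 * g * (2 * x - 1) * (2 * x - 1) + 3/8 * (y - x) * (2 * x - 1) * (2 * x - 1)
      + 1/2 * (r - w) * (w - 2 * g)^2"
    unfolding core_def by algebra
  also have "\<dots> \<ge> 0"
    using assms by (intro add_nonneg_nonneg mult_nonneg_nonneg zero_le_power2) auto
  finally show ?thesis .
qed

text \<open>Triple \<open>(5, 7, 7)\<close> with \<open>q \<le> 1/2 \<le> p\<close>. The summand
  \<open>4 * g * (1 - 2 * x)\<close> is what the constraint \<open>h \<le> 1 - p\<close>
  yields.\<close>

lemma core_left_mid: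
  fixes x y r w g :: real
  assumes "0 \<le> w" "0 \<le> g" "0 \<le> r - w" "0 \<le> 1 - r - w" "0 \<le> 1 - y - g"
      "0 \<le> 2 * y - 1" "0 \<le> 1 - 2 * x" "0 \<le> x"
  shows "0 \<le> core x y r + w * (1 - 5 * y - y^2 + 3 * x + 2 * x^2) - w * g * (7 - g - 2 * w)
      + w^2 * (3 - x - w) + g^2 * (2 - g) + 4 * g * (1 - 2 * x)"
proof -
  have "core x y r + w * (1 - 5 * y - y^2 + 3 * x + 2 * x^2) - w * g * (7 - g - 2 * w)
      + w^2 * (3 - x - w) + g^2 * (2 - g) + 4 * g * (1 - 2 * x) =
      1/2 * (1 - 2 * x) * (r - x)^2 + 1/8 * (1 - r - w) * (2 * y - 1) * (2 * y - 1)
      + 1/2 * (r - w) * (1 - y - g) * (2 * y - 1) + 1/2 * (2 * y - 1) * (2 * y - 1)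
      + 23/8 * g * (r - w) * (1 - 2 * x) + g * (1 - r - w) * (1 - y - g)
      + 3/8 * w * (1 - 2 * x) * (1 - 2 * x) + 3/4 * w * (1 - r - w) * (1 - y - g)
      + 3/8 * (r - w) * (2 * y - 1) * (2 * y - 1) + (2 * y - 1) * x
      + 3/4 * w * (r - w) * (1 - y - g) + 1/2 * w * w * (1 - 2 * x) + 4 * g * (r - x)^2
      + 5/4 * (1 - r - w) * (1 - y - g) * x + 1/2 * (1 - r - w) * (1 - r - w)
      + 3 * x * (w - g)^2 + 1/4 * g * (1 - y - g) * (2 * y - 1)
      + 9/4 * g * (1 - r - w) * (1 - 2 * x) + (r - w) * (r - w) * (1 - r - w)
      + 5/4 * (r - w) * (1 - r - w) * (1 - 2 * x)
      + 1/8 * (1 - r - w) * (1 - r - w) * (1 - 2 * x) + g * g * (1 - r - w)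
      + 3/8 * (1 - r - w) * (2 * y - 1) + 1/4 * (2 * y - 1) * (2 * y - 1) * (1 - 2 * x)
      + 5/8 * (r - w) * (1 - 2 * x) * x + 1/8 * (2 * y - 1) * (2 * y - 1) * (2 * y - 1)
      + 17/8 * w * (1 - r - w) * (2 * y - 1) + (1 - r - w) * (1 - r - w) * (2 * y - 1)
      + 1/2 * (1 - y - g) * (w - g)^2 + 5/4 * g * (1 - 2 * x) * x + 3/4 * (1 - r - w) * x * x
      + 3/2 * g * g * (1 - 2 * x) + 1/8 * g * (2 * y - 1) * (2 * y - 1)
      + w * (r - w) * (1 - r - w) + 1/8 * w * (r - w) * (2 * y - 1)
      + 11/2 * w * (1 - y - g) * x + 4 * (1 - y - g) * (r - x)^2 + 1/2 * g * g * (1 - y - g)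
      + 9/8 * g * (1 - 2 * x) + 5/4 * (1 - y - g) * (1 - 2 * x) * x
      + 3/8 * g * (2 * y - 1) * (1 - 2 * x) + 1/2 * (1 - 2 * x) * (1 - 2 * x) * x
      + 7/16 * (r - w) * (2 * y - 1) + 3/4 * (2 * y - 1) * (w - g)^2
      + 3/4 * g * (2 * y - 1) * x + 1/8 * (r - w) * (r - w) * (1 - 2 * x)
      + 27/16 * (r - w) * (2 * y - 1) * (1 - 2 * x) + w * w * g
      + 5/4 * (1 - r - w) * (2 * y - 1) * x + w * w * (1 - r - w) + 3/4 * (2 * y - 1) * x * x
      + 1/8 * g * (1 - r - w)"
    unfolding core_def by algebra
  also have "\<dots> \<ge> 0"
    using assms by (intro add_nonneg_nonneg mult_nonneg_nonneg zero_le_power2) auto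
  finally show ?thesis .
qed

text \<open>The value at \<open>g = 0\<close> of the linearisation in
  \<open>core_left_nonneg\<close>, for \<open>1/2 \<le> q \<le> p\<close>; the next lemma treats the
  other end \<open>g = y\<close>.\<close>

lemma core_left_low:
  fixes x y r w :: real
  assumes "0 \<le> y - x" "0 \<le> 1 - 2 * y" "0 \<le> x" "0 \<le> w" "0 \<le> r - w"
      "0 \<le> 1 - r - w"
  shows "0 \<le> core x y r + w * (1 - 5 * y - y^2 + 3 * x + 2 * x^2) + w^2 * (3/2 - x - 2 * w)"
proof -
  have "core x y r + w * (1 - 5 * y - y^2 + 3 * x + 2 * x^2) + w^2 * (3/2 - x - 2 * w) =
      93/68 * x * x * (1 - r - w) + 1/9 * x * (3 * r)^2 + 9/17 * (y - x) * (y - x) * w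
      + (y - x) * (y - x) * (1 - r - w) + 3/34 * (1 - 2 * y) * (4 * r - 2 * x)^2
      + 6 * (y - x) * (y - x) * (r - w) + 25/68 * (y - x) * (2 * r - 3 * x)^2
      + 603/68 * (y - x) * (y - x) * x + 1/2 * (1 - 2 * y) * w * w + 195/68 * x * x * w
      + 13/102 * (1 - r - w) * (2 * r - 2 * y)^2 + 8/153 * w * (3 * r - 3 * x - 3 * y)^2
      + 9/17 * (y - x) * (r - w) * (r - w) + 2 * (y - x) * (1 - 2 * y) * (r - w)
      + 251/68 * (y - x) * x * x + (1 - 2 * y) * (1 - 2 * y) * w
      + 77/17 * (y - x) * (1 - 2 * y) * x + 9/68 * w * (2 * r - 3 * x)^2
      + 3/17 * (1 - 2 * y) * (3 * r - 2 * x)^2 + w * w * (r - w) + w * w * (1 - r - w)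
      + 109/17 * (y - x) * x * (r - w) + 9/68 * x * (2 * r - x - 3 * y)^2
      + 8/17 * (y - x) * w * w + 25/204 * (1 - r - w) * (2 * r - 3 * x - 2 * y)^2
      + 2 * (1 - 2 * y) * x * w + (y - x) * (y - x)^2 + (y - x) * (1 - 2 * y) * w"
    unfolding core_def by algebra
  also have "\<dots> \<ge> 0"
    using assms by (intro add_nonneg_nonneg mult_nonneg_nonneg zero_le_power2) auto
  finally show ?thesis .
qed

lemma core_left_low_penalty:
  fixes x y r w :: real
  assumes "0 \<le> y - x" "0 \<le> 1 - 2 * y" "0 \<le> x" "0 \<le> w" "0 \<le> r - w"
      "0 \<le> 1 - r - w"
  shows "0 \<le> core x y r + w * (1 - 5 * y - y^2 + 3 * x + 2 * x^2) + w^2 * (3/2 - x - 2 * w)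
      + 4 * y * (1 - 2 * x - w + w^2)"
proof -
  have "core x y r + w * (1 - 5 * y - y^2 + 3 * x + 2 * x^2) + w^2 * (3/2 - x - 2 * w)
      + 4 * y * (1 - 2 * x - w + w^2) =
      97/80 * x * x * (1 - r - w) + 1/2 * (1 - 2 * y) * (r - w) * (r - w) + w * (r - w - y)^2
      + 7/2 * (1 - 2 * y) * (w - y)^2 + 7/3 * (y - x) * (y - x) * (1 - r - w)
      + 49/30 * x * (1 - r - w) * (1 - r - w) + 713/3240 * (1 - 2 * y) * (2 * r - 3 * x)^2
      + 15/2 * (y - x) * x * (1 - r - w) + 71/30 * (1 - 2 * y) * (1 - 2 * y) * x
      + 247/3240 * (1 - 2 * y) * (4 * r - 3 * x)^2 + 359/30 * (y - x) * w * (r - w)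
      + 7/80 * (1 - r - w) * (4 * r - x)^2 + 41/30 * (r - w) * (w - y/2)^2
      + 142/15 * (y - x) * (w - y/2)^2 + 4/3 * (y - x) * (w - y)^2
      + 19/5 * (y - x) * (r - w) * (r - w) + 7/6 * (y - x) * (1 - 2 * y)
      + 53/30 * (r - w) * (y - x)^2 + 2 * (1 - 2 * y) * w * (r - w) + 32/15 * x * (y - x)^2
      + 4/45 * w * (3 * r - 3 * y)^2 + 17/15 * w * w * (r - w) + 1/2 * w * w * (1 - r - w)
      + 1/40 * (r - w) * (4 * r - 2 * x - 3 * y)^2 + (1 - 2 * y) * w * (1 - r - w)
      + 259/120 * (y - x) + 27/40 * (y - x) * (1 - 2 * y) * (1 - 2 * y)
      + 43/60 * x * (2 * r - 2 * x)^2 + 208/27 * (1 - 2 * y) * x * w + 4 * (y - x) * (y - x)^2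
      + 6/5 * (y - x) * (y - x) * (1 - 2 * y) + 194/135 * (1 - 2 * y) * x * (r - w)"
    unfolding core_def by algebra
  also have "\<dots> \<ge> 0"
    using assms by (intro add_nonneg_nonneg mult_nonneg_nonneg zero_le_power2) auto
  finally show ?thesis .
qed

lemma core_right_high:
  fixes x y r w g :: real
  assumes "0 \<le> x - y" "0 \<le> 1 - x" "0 \<le> w" "0 \<le> g" "0 \<le> r - w"
      "0 \<le> 1 - r - w" "0 \<le> 2 * y - 1" "0 \<le> 1 - y - g"
  shows "0 \<le> core x y r + 2 * (x - y) + w * (-1 - 3 * y - y^2 + 3 * x + 2 * x^2)
      - w * g * (5 - g - 2 * w) + w^2 * (3 - x - w) + g^2 * (2 - g)"
proof -
  have "core x y r + 2 * (x - y) + w * (-1 - 3 * y - y^2 + 3 * x + 2 * x^2)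
      - w * g * (5 - g - 2 * w) + w^2 * (3 - x - w) + g^2 * (2 - g) =
      9 * (x - y) * w * (2 * y - 1) + 1/2 * w * (2 * y - 1) * (2 * y - 1)
      + (1 - y - g) * (w - g)^2 + 3/2 * (2 * y - 1) * (w - g)^2
      + 1/2 * (1 - x) * (r - w) * (1 - y - g) + 4 * (y - 1/2)^2 + 5 * (x - y) * w * (1 - r - w)
      + 1/2 * w * (2 * y - 1) * (1 - y - g) + 2 * (x - y) * g * g
      + 5/4 * (1 - r - w) * (1 - r - w) * (1 - r - w) + 11/4 * w * (2 * y - 1)
      + 1/2 * (1 - x) * g * (r - w) + 2 * (x - y) * w * w + (x - y) * (x - y) * (x - y)
      + 5/2 * (1 - r - w) * (2 * y - 1) + 4 * (x - y) * (1 - r - w) * (1 - r - w)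
      + 3/4 * (x - y) * (2 * y - 1) + 3/2 * (x - y) * (x - y) * (2 * y - 1) + 3 * w * (r - x)^2
      + 1/2 * (1 - r - w) * (w - g)^2 + 5/4 * (r - w) * (r - w) * (1 - r - w)
      + 3/2 * (r - w) * (x - r)^2 + 3/4 * w * (r - w) * (2 * y - 1)
      + 14 * (x - y) * w * (1 - y - g) + 3/2 * w * (1 - r - w) * (1 - r - w)
      + 1/2 * w * (r - w) * (1 - y - g) + 3/4 * (x - y) * (1 - r - w) * (2 * y - 1)
      + (1 - r - w) * (1 - r - w) * (2 * y - 1) + 3/2 * w * (r - w) * (1 - r - w)
      + 2 * (1 - x) * (w - g)^2 + (1 - r - w) * (y - 1/2)^2 + (1 - x) * w * (1 - y - g)
      + 9 * (x - y) * w * g + 1/2 * (x - y) * (x - y) * (1 - r - w)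
      + 1/2 * w * (1 - r - w) * (1 - y - g) + 1/2 * w * w * (1 - r - w)
      + (1 - x) * (1 - x) * (1 - r - w) + 1/4 * (x - y) * (2 * y - 1) * (2 * y - 1)
      + 5/4 * (x - y) * (1 - r - w) + 1/2 * (r - w) * (w - g)^2
      + 5/4 * w * (1 - r - w) * (2 * y - 1) + 2 * (x - y) * (x - y) * w + w * (1 - r)^2"
    unfolding core_def by algebra
  also have "\<dots> \<ge> 0"
    using assms by (intro add_nonneg_nonneg mult_nonneg_nonneg zero_le_power2) auto
  finally show ?thesis .
qed

text \<open>The \<open>g\<close>-free part of the slack isolated in
  \<open>core_right_nonneg\<close>, for the triple \<open>(7, 5, 7)\<close>. The two sides of
  \<open>y = 1/4\<close> have separate certificates.\<close>

lemma core_right_low: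
  fixes x y r w :: real
  assumes "0 \<le> 2 * x - 1" "0 \<le> 1 - x" "0 \<le> 1 - 4 * y" "0 \<le> y" "0 \<le> w"
      "0 \<le> r - w" "0 \<le> 1 - r - w"
  shows "0 \<le> core x y r + 2 * (x - y) + w * (-1 - 5 * y - y^2 + 3 * x + 2 * x^2)
      + w^2 * (3/2 - x - 2 * w + 4 * y)"
proof -
  have "core x y r + 2 * (x - y) + w * (-1 - 5 * y - y^2 + 3 * x + 2 * x^2)
      + w^2 * (3/2 - x - 2 * w + 4 * y) =
      1/3 * (1 - x) * (1 - x) * (1 - 4 * y) + 1/2 * w * w * (r - w)
      + 2 * (1 - x) * (1 - 4 * y) * w + 1/3 * (1 - x) * w * (r - w)
      + 1/2 * (1 - 4 * y) * (r - x)^2 + 4 * (2 * x - 1) * y * (1 - r - w)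
      + 17/3 * (2 * x - 1) * (1 - x) * w + 10/3 * (1 - x) * (x - r)^2
      + 1/4 * (1 - 4 * y) * y * w + w * w * (1 - r - w) + 1/3 * (1 - r - w) * (1 - r)^2
      + 1/2 * (1 - r - w) * (r - w - x)^2 + 49/12 * (1 - x) * y * y + 1/6 * y * y * y
      + (2 * x - 1) * w * w + 3/4 * (2 * x - 1) * y * w + 5/4 * (1 - x) * (w - y)^2
      + 13/12 * (1 - x) * w * w + 5/6 * y * (y - 2 + 2 * x)^2 + (1 - x) * (1 - 4 * y) * (r - w)
      + 7/2 * (2 * x - 1) * (2 * x - 1) * w + 2/3 * (2 * x - 1) * (1 - x) * (1 - x)
      + 1/6 * (1 - r - w) * (r - x)^2 + 1/2 * (1 - 4 * y) * w * (1 - r - w)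
      + 3/2 * (2 * x - 1) * (r - x)^2 + 1/2 * (1 - 4 * y) * w * (r - w)"
    unfolding core_def by algebra
  also have "\<dots> \<ge> 0"
    using assms by (intro add_nonneg_nonneg mult_nonneg_nonneg zero_le_power2) auto
  finally show ?thesis .
qed

lemma core_right_mid:
  fixes x y r w :: real
  assumes "0 \<le> 2 * x - 1" "0 \<le> 1 - x" "0 \<le> 4 * y - 1" "0 \<le> 1 - 2 * y" "0 \<le> w"
      "0 \<le> r - w" "0 \<le> 1 - r - w"
  shows "0 \<le> core x y r + 2 * (x - y) + w * (-1 - 5 * y - y^2 + 3 * x + 2 * x^2)
      + w^2 * (3/2 - x - 2 * w + 4 * y)"
proof -
  have "core x y r + 2 * (x - y) + w * (-1 - 5 * y - y^2 + 3 * x + 2 * x^2)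
      + w^2 * (3/2 - x - 2 * w + 4 * y) =
      119/120 * (2 * x - 1) * (1 - r - w) + 13/96 * (4 * y - 1) * (1 - r - w)
      + 1/120 * (2 * x - 1) * (r - w) * (1 - r - w)
      + 41/1920 * (2 * x - 1) * (4 * y - 1) * (4 * y - 1)
      + 35/96 * (4 * y - 1) * (1 - r - w) * (1 - r - w) + 191/240 * (1 - x) * (y - 1 + x)^2
      + 13/12 * (1 - 2 * y) * w * w + 1/8 * (4 * y - 1) * (1 - 2 * y) * w
      + 5/96 * (2 * x - 1) * (4 * y - 1) * (1 - r - w) + 29/15 * (1 - x) * (r - 3 * x/4)^2
      + 37/30 * w * w * (1 - r - w) + 103/120 * (1 - r - w) * (r - w - x)^2
      + 13/16 * (4 * y - 1) * (r - w) * (1 - r - w) + 35/96 * (4 * y - 1) * (r - w - x)^2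
      + 1/2 * (1 - x) * (1 - 2 * y) * w + 29/30 * (2 * x - 1) * (1 - x - y/2)^2
      + 31/60 * (2 * x - 1) * w * (1 - r - w) + 16/15 * (2 * x - 1) * w * w
      + 5/6 * (1 - 2 * y) * (r - x)^2 + 13/60 * w * (r - w) * (1 - r - w)
      + 1/120 * (y - 1 + x)^2 + 7/8 * (2 * x - 1) * (1 - 2 * y) * w
      + 59/16 * (1 - x) * (y - 1/2)^2 + 19/48 * (1 - x) * (1 - x) * (1 - 2 * y)
      + 3/20 * (1 - x) * w * w + 39/16 * (2 * x - 1) * w + 19/40 * (2 * x - 1) * (x - r)^2
      + 13/16 * (2 * x - 1) * (2 * x - 1) * w + 41/480 * (4 * y - 1) * (y - 1/2)^2
      + 59/120 * (1 - r - w)^2 + 4/15 * (1 - r - w) * (r - x)^2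
      + 79/480 * (4 * y - 1) * (y - 1 + x)^2 + 1/8 * (r - w) * (r - w - x)^2"
    unfolding core_def by algebra
  also have "\<dots> \<ge> 0"
    using assms by (intro add_nonneg_nonneg mult_nonneg_nonneg zero_le_power2) auto
  finally show ?thesis .
qed

lemma no_arcs_nonneg:
  fixes p r w :: real
  assumes "0 \<le> p" "0 \<le> 1 - p" "0 \<le> w" "0 \<le> r - w" "0 \<le> 1 - r - w"
  shows "0 \<le> 2 - 4 * p + p^2 + 4 * r - r^2
      - (p * w * (6 - 2 * p - w) + (1 - p) * r * (6 - r) - w^2 * (2 - w) - p^2 * (2 - p))"
proof -
  have "2 - 4 * p + p^2 + 4 * r - r^2
      - (p * w * (6 - 2 * p - w) + (1 - p) * r * (6 - r) - w^2 * (2 - w) - p^2 * (2 - p)) =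
      1/2 * (r - w) * (p - w)^2 + 3 * p * w * (r - w) + 2 * (1 - r - w) * (1 - p - r)^2
      + 1/2 * (r - w) * (1 - r - w) * (1 - r - w) + 3/2 * (1 - p) * w * (1 - r - w)
      + 3 * p * (r - w) * (1 - r - w) + 2 * (1 - p) * (r - w) * (1 - r - w)
      + p * (r - w) * (r - w) + 1/2 * p * (1 - p) * w + (1 - p) * (p - w)^2
      + 3 * w * (1 - p - r)^2 + 1/2 * (1 - p) * w * (r - w) + 3/2 * (1 - p) * (1 - p) * w
      + 3/2 * (r - w) * (1 - p - r)^2"
    by algebra
  also have "\<dots> \<ge> 0"
    using assms by (intro add_nonneg_nonneg mult_nonneg_nonneg zero_le_power2) auto
  finally show ?thesis .
qed

text \<open>For \<open>k = 5\<close> this is what a vertex of weight \<open>s\<close> with target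
  weight \<open>u\<close> contributes beyond \<open>s\<close>, once incoming terms have been moved
  to the source of each arc. A larger \<open>k\<close> adds \<open>(k - 5) * (s * u)\<close>, the
  charge for pairs of arcs.\<close>

definition excess :: "real \<Rightarrow> real \<Rightarrow> real \<Rightarrow> real" where
  "excess k s u = s * (u * (k - 2 * s - u) - s * (2 - s))"

lemma core_left_nonneg:
  fixes x y r w g :: real
  assumes x: "0 \<le> x" and xy: "x \<le> y" and y: "y \<le> 1"
    and w: "0 \<le> w" "w \<le> r" "w \<le> 1 - r" and g: "0 \<le> g" "g \<le> y" "g \<le> 1 - y"
  shows "0 \<le> core x y r + w * (1 - 5 * y - y^2 + 3 * x + 2 * x^2) - w * g * (7 - g - 2 * w)
    + w^2 * (3 - x - w) + g^2 * (2 - g) + g * max 0 (4 * (1 - 2 * x))"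
    (is "0 \<le> ?D + g * ?m")
proof (cases "x \<le> 1/2")
  case False
  then have "0 \<le> ?D"
    using core_left_high[of w g r y x] assms by simp
  then show ?thesis
    using g by simp
next
  case True
  show ?thesis
  proof (cases "y \<le> 1/2")
    case False
    with True show ?thesis
      using core_left_mid[of w g r y x] assms by (simp add: mult.assoc mult.left_commute max_def)
  next
    case y2: True
    let ?L = "core x y r + w * (1 - 5 * y - y^2 + 3 * x + 2 * x^2) + w^2 * (3/2 - x - 2 * w)"
    let ?k = "1 - 2 * x - w + w^2"
    \<comment> \<open>Linearising the convex dependence on \<open>g\<close> at \<open>g = w\<close> leaves only the endpoints \<open>0\<close> and \<open>y\<close>.\<close>
    have eq: "?D + 4 * g * (1 - 2 * x) = ?L + 4 * g * ?k + (3/2 + w) * (g - w)^2 + g^2 * (1/2 - g)"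
      by algebra
    have L0: "0 \<le> ?L"
      using core_left_low[of y x w r] assms y2 by simp
    have L1: "0 \<le> ?L + 4 * y * ?k"
      using core_left_low_penalty[of y x w r] assms y2 by simp
    have "0 \<le> ?L + 4 * g * ?k"
    proof (cases "0 \<le> ?k")
      case True
      then have "0 \<le> 4 * g * ?k" using g by simp
      with L0 show ?thesis by linarith
    next
      case False
      then have "4 * y * ?k \<le> 4 * g * ?k"
        using g by (intro mult_right_mono_neg) auto
      with L1 show ?thesis by linarith
    qed
    moreover have "0 \<le> (3/2 + w) * (g - w)^2 + g^2 * (1/2 - g)"
      using assms y2 by (intro add_nonneg_nonneg mult_nonneg_nonneg) auto
    ultimately have "0 \<le> ?D + 4 * g * (1 - 2 * x)"
      unfolding eq by linarith
    with True show ?thesis by (simp add: mult.assoc mult.left_commute max_def)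
  qed
qed

lemma core_right_nonneg:
  fixes x y r w g :: real
  assumes x: "1/2 \<le> x" "x \<le> 1" and y: "0 \<le> y" "y \<le> x"
    and w: "0 \<le> w" "w \<le> r" "w \<le> 1 - r" and g: "0 \<le> g" "g \<le> y" "g \<le> 1 - y"
  shows "0 \<le> core x y r + 2 * (x - y) + w * (- 1 - 3 * y - y^2 + 3 * x + 2 * x^2)
    - w * g * (5 - g - 2 * w) + w^2 * (3 - x - w) + g^2 * (2 - g)" (is "0 \<le> ?D")
proof (cases "y \<le> 1/2")
  case False
  then show ?thesis
    using core_right_high[of x y w g r] assms by simp
next
  case True
  let ?L = "core x y r + 2 * (x - y) + w * (- 1 - 5 * y - y^2 + 3 * x + 2 * x^2)
    + w^2 * (3/2 - x - 2 * w + 4 * y)"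
  \<comment> \<open>Completing the square at \<open>g = w\<close> leaves a term linear in
    \<open>g\<close>. Its slope \<open>- 2 * w * (1 - 2 * w)\<close> is not positive because
    \<open>w \<le> 1/2\<close>, so \<open>g = y\<close> is its worst case, and \<open>?L\<close> is
    free of \<open>g\<close>.\<close>
  have eq: "?D = ?L + (3/2 + w) * (g - w)^2 + g^2 * (1/2 - g) + 2 * w * (1 - 2 * w) * (y - g)"
    by algebra
  have "0 \<le> ?L"
    using core_right_low[of x y w r] core_right_mid[of x y w r] assms True
    by (cases "y \<le> 1/4") simp_all
  moreover have "0 \<le> (3/2 + w) * (g - w)^2 + g^2 * (1/2 - g) + 2 * w * (1 - 2 * w) * (y - g)"
    using assms True by (intro add_nonneg_nonneg mult_nonneg_nonneg) auto
  ultimately show ?thesis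
    unfolding eq by linarith
qed

text \<open>
  \<open>h\<close> is the weight of \<open>a'\<close>.  The triple \<open>(\<alpha>, \<beta>, \<gamma>)\<close> records which linear bound for the number of
  pairs of arcs is used; no single one of them suffices for all weights.
\<close>

lemma one_missing_arc:
  fixes p q r w g h :: real
  assumes p: "0 \<le> p" "p \<le> 1" and q: "0 \<le> q" "q \<le> 1"
    and w: "0 \<le> w" "w \<le> r" "w \<le> 1 - r"
    and g: "0 \<le> g" "g \<le> q" "g \<le> 1 - q"
    and h: "0 \<le> h" "h \<le> p" "h \<le> 1 - p"
  obtains \<alpha> \<beta> \<gamma> where "(\<alpha>, \<beta>, \<gamma>) \<in> {(6, 6, 6), (7, 5, 7), (5, 7, 7)}"
    "excess \<gamma> p w + (1 - p) * (r * (\<gamma> - r))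
     + excess \<alpha> q p + excess \<alpha> g h + (1 - q - g) * (p * (\<alpha> - p))
     + excess \<beta> r q + excess \<beta> w g + (1 - r - w) * (q * (\<beta> - q)) \<le> 6"
proof -
  define T where "T \<alpha> \<beta> \<gamma> = excess \<gamma> p w + (1 - p) * (r * (\<gamma> - r))
     + excess \<alpha> q p + excess \<alpha> g h + (1 - q - g) * (p * (\<alpha> - p))
     + excess \<beta> r q + excess \<beta> w g + (1 - r - w) * (q * (\<beta> - q))" for \<alpha> \<beta> \<gamma>
  define x y where "x = 1 - p" and "y = 1 - q"
  have pq: "p = 1 - x" "q = 1 - y" by (auto simp: x_def y_def)
  have gh: "0 \<le> g * (2 * g * h)" using g h by simp
  consider "x \<le> y" | "y \<le> x" "x \<le> 1/2" | "y \<le> x" "1/2 \<le> x" by linarith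
  then show thesis
  proof cases
    case 1
    \<comment> \<open>From \<open>h \<le> 1 - p = x\<close> one gets
      \<open>p - h \<ge> 1 - 2 * x\<close>, while \<open>p + h \<le> 1\<close> makes the factor
      \<open>5 - p - h\<close> at least \<open>4\<close>.\<close>
    have "4 * (1 - 2 * x) \<le> 4 * (p - h)" "0 \<le> 4 * (p - h)"
      using h by (auto simp: pq)
    moreover have "4 * (p - h) \<le> (5 - p - h) * (p - h)"
      using h by (intro mult_right_mono) auto
    ultimately have "g * max 0 (4 * (1 - 2 * x)) \<le> g * ((5 - p - h) * (p - h))"
      using g by (intro mult_left_mono) auto
    moreover have "6 - T 5 7 7 = core x y r + w * (1 - 5 * y - y^2 + 3 * x + 2 * x^2)
        - w * g * (7 - g - 2 * w) + w^2 * (3 - x - w) + g^2 * (2 - g)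
        + g * ((5 - p - h) * (p - h)) + g * (2 * g * h)"
      unfolding T_def excess_def core_def pq by algebra
    moreover have "0 \<le> core x y r + w * (1 - 5 * y - y^2 + 3 * x + 2 * x^2)
        - w * g * (7 - g - 2 * w) + w^2 * (3 - x - w) + g^2 * (2 - g) + g * max 0 (4 * (1 - 2 * x))"
      using 1 assms by (intro core_left_nonneg) (auto simp: pq)
    ultimately have "T 5 7 7 \<le> 6"
      using gh by linarith
    with that[of 5 7 7] show thesis
      by (simp add: T_def)
  next
    case 2
    have "0 \<le> g * ((p - h) * (6 - p - h))"
      using assms by (intro mult_nonneg_nonneg) auto
    moreover have "6 - T 6 6 6 = core x y r + (x - y) + x * r + w * (1 - 4 * y - y^2 + 2 * x + 2 * x^2)
        - w * g * (6 - g - 2 * w) + w^2 * (3 - x - w) + g^2 * (2 - g)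
        + g * ((p - h) * (6 - p - h)) + g * (2 * g * h)"
      unfolding T_def excess_def core_def pq by algebra
    moreover have "0 \<le> core x y r + (x - y) + x * r + w * (1 - 4 * y - y^2 + 2 * x + 2 * x^2)
        - w * g * (6 - g - 2 * w) + w^2 * (3 - x - w) + g^2 * (2 - g)"
      using 2 assms by (intro core_middle) (auto simp: pq)
    ultimately have "T 6 6 6 \<le> 6"
      using gh by linarith
    with that[of 6 6 6] show thesis
      by (simp add: T_def)
  next
    case 3
    have "0 \<le> g * ((p - h) * (7 - p - h))"
      using assms by (intro mult_nonneg_nonneg) auto
    moreover have "6 - T 7 5 7 = core x y r + 2 * (x - y) + w * (- 1 - 3 * y - y^2 + 3 * x + 2 * x^2)
        - w * g * (5 - g - 2 * w) + w^2 * (3 - x - w) + g^2 * (2 - g)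
        + g * ((p - h) * (7 - p - h)) + g * (2 * g * h)"
      unfolding T_def excess_def core_def pq by algebra
    moreover have "0 \<le> core x y r + 2 * (x - y) + w * (- 1 - 3 * y - y^2 + 3 * x + 2 * x^2)
        - w * g * (5 - g - 2 * w) + w^2 * (3 - x - w) + g^2 * (2 - g)"
      using 3 assms by (intro core_right_nonneg) (auto simp: pq)
    ultimately have "T 7 5 7 \<le> 6"
      using gh by linarith
    with that[of 7 5 7] show thesis
      by (simp add: T_def)
  qed
qed

section \<open>Three cliques\<close>

text \<open>The difference quotient in \<open>u\<close> is \<open>s * (k - 2 * s - u - u')\<close>,
  whose second factor is at least \<open>5 - 2 - 1 - 1\<close>.\<close>

lemma excess_mono:
  assumes "0 \<le> s" "s \<le> 1" "u \<le> u'" "u' \<le> 1" "5 \<le> k"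
  shows "excess k s u \<le> excess k s u'"
proof -
  have "excess k s u' - excess k s u = s * ((u' - u) * (k - 2 * s - u - u'))"
    unfolding excess_def by algebra
  moreover have "0 \<le> s * ((u' - u) * (k - 2 * s - u - u'))"
    using assms by (intro mult_nonneg_nonneg) auto
  ultimately show ?thesis by linarith
qed

text \<open>This bound is linear in the mass \<open>s\<close>, so all vertices not singled out can
  be handled together.\<close>

lemma excess_le:
  assumes "0 \<le> s" "s \<le> 1" "0 \<le> u"
  shows "excess k s u \<le> s * (u * (k - u))"
proof -
  have "s * (u * (k - u)) - excess k s u = s * (s * (2 * u + (2 - s)))"
    unfolding excess_def by algebra
  moreover have "0 \<le> s * (s * (2 * u + (2 - s)))"
    using assms by (intro mult_nonneg_nonneg) auto
  ultimately show ?thesis by linarith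
qed

text \<open>The vertex of weight \<open>s1\<close> is optional; \<open>s1 = 0\<close> encodes its absence.\<close>

lemma sum_excess_le:
  fixes s u :: "'v \<Rightarrow> real"
  assumes fin: "finite T" and s: "\<And>t. t \<in> T \<Longrightarrow> 0 \<le> s t" "sum s T = 1"
    and u: "\<And>t. t \<in> T \<Longrightarrow> 0 \<le> u t" "\<And>t. t \<in> T \<Longrightarrow> u t \<le> \<rho>" and \<rho>: "\<rho> \<le> 1" and k: "5 \<le> k"
    and t0: "t0 \<in> T" "u t0 \<le> \<rho>0" "\<rho>0 \<le> 1"
    and t1: "s1 = 0 \<or> (\<exists>t1\<in>T. t1 \<noteq> t0 \<and> s t1 = s1 \<and> u t1 \<le> \<rho>1)" and \<rho>1: "\<rho>1 \<le> 1"
  shows "(\<Sum>t\<in>T. excess k (s t) (u t))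
    \<le> excess k (s t0) \<rho>0 + excess k s1 \<rho>1 + (1 - s t0 - s1) * (\<rho> * (k - \<rho>))"
proof -
  have s1: "s t \<le> 1" if "t \<in> T" for t
    using member_le_sum[of t T s] that s fin by auto
  have each: "excess k (s t) (u t) \<le> s t * (\<rho> * (k - \<rho>))" if "t \<in> T" for t
  proof -
    have "excess k (s t) (u t) \<le> excess k (s t) \<rho>"
      using that s s1 u \<rho> k by (intro excess_mono) auto
    also have "\<dots> \<le> s t * (\<rho> * (k - \<rho>))"
      using that s s1 u(1)[OF that] u(2)[OF that] by (intro excess_le) auto
    finally show ?thesis .
  qed
  have e0: "excess k (s t0) (u t0) \<le> excess k (s t0) \<rho>0"
    using t0 s s1 k by (intro excess_mono) auto
  show ?thesis
  proof (cases "s1 = 0")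
    case True
    have "(\<Sum>t\<in>T. excess k (s t) (u t))
        = excess k (s t0) (u t0) + (\<Sum>t\<in>T - {t0}. excess k (s t) (u t))"
      using fin t0 by (simp add: sum.remove)
    also have "(\<Sum>t\<in>T - {t0}. excess k (s t) (u t)) \<le> (\<Sum>t\<in>T - {t0}. s t * (\<rho> * (k - \<rho>)))"
      using each by (intro sum_mono) auto
    also have "\<dots> = (1 - s t0) * (\<rho> * (k - \<rho>))"
      using fin t0 s(2) by (simp add: sum_distrib_right[symmetric] sum_diff1)
    finally show ?thesis
      using e0 True by (simp add: excess_def)
  next
    case False
    with t1 obtain t1 where t1: "t1 \<in> T" "t1 \<noteq> t0" "s t1 = s1" "u t1 \<le> \<rho>1" by auto
    have e1: "excess k (s t1) (u t1) \<le> excess k s1 \<rho>1"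
      unfolding t1(3)[symmetric] using t1 s s1 k \<rho>1 by (intro excess_mono) auto
    have "(\<Sum>t\<in>T. excess k (s t) (u t))
        = excess k (s t0) (u t0) + excess k (s t1) (u t1) + (\<Sum>t\<in>T - {t0} - {t1}. excess k (s t) (u t))"
      using fin t0 t1 by (simp add: sum.remove)
    also have "(\<Sum>t\<in>T - {t0} - {t1}. excess k (s t) (u t))
        \<le> (\<Sum>t\<in>T - {t0} - {t1}. s t * (\<rho> * (k - \<rho>)))"
      using each by (intro sum_mono) auto
    also have "\<dots> = (1 - s t0 - s1) * (\<rho> * (k - \<rho>))"
      using fin t0 t1 s(2) by (simp add: sum_distrib_right[symmetric] sum_diff1)
    finally show ?thesis
      using e0 e1 by linarith
  qed
qed

section \<open>Three weighted parts with arcs around a cycle\<close>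

locale cyclic_triple =
  fixes A B C :: "'v set" and s :: "'v \<Rightarrow> real" and E :: "'v \<Rightarrow> 'v \<Rightarrow> bool"
  assumes finite_A: "finite A" and finite_B: "finite B" and finite_C: "finite C"
    and nonneg: "\<And>v. 0 \<le> s v"
    and sum_A: "sum s A = 1" and sum_B: "sum s B = 1" and sum_C: "sum s C = 1"
    and unique_BA: "\<And>b a a'. b \<in> B \<Longrightarrow> a \<in> A \<Longrightarrow> a' \<in> A \<Longrightarrow> E b a \<Longrightarrow> E b a' \<Longrightarrow> a = a'"
    and unique_CB: "\<And>c b b'. c \<in> C \<Longrightarrow> b \<in> B \<Longrightarrow> b' \<in> B \<Longrightarrow> E c b \<Longrightarrow> E c b' \<Longrightarrow> b = b'"
    and unique_AC: "\<And>a c c'. a \<in> A \<Longrightarrow> c \<in> C \<Longrightarrow> c' \<in> C \<Longrightarrow> E a c \<Longrightarrow> E a c' \<Longrightarrow> c = c'"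
    and no_triangle: "\<And>a b c. a \<in> A \<Longrightarrow> b \<in> B \<Longrightarrow> c \<in> C \<Longrightarrow> E b a \<Longrightarrow> E c b \<Longrightarrow> E a c \<Longrightarrow> False"
begin

text \<open>Used in two ways: towards the preceding part it is the weight of the unique target, or
  \<open>0\<close> if there is none; towards the following part, once \<open>E\<close> is symmetric,
  it is the mass from which arcs arrive.\<close>

definition out :: "'v set \<Rightarrow> 'v \<Rightarrow> real" where
  "out T v = (\<Sum>w\<in>T. s w * of_bool (E v w))"

text \<open>As each part has mass \<open>1\<close>, this is an expectation over independent
  vertices, and a variable absent from \<open>F\<close> sums out.\<close>

definition expect :: "('v \<Rightarrow> 'v \<Rightarrow> 'v \<Rightarrow> real) \<Rightarrow> real" where
  "expect F = (\<Sum>a\<in>A. \<Sum>b\<in>B. \<Sum>c\<in>C. s a * s b * s c * F a b c)"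

text \<open>The three pairs of arcs meet in \<open>b\<close>, \<open>c\<close> and \<open>a\<close>;
  they arise from the mixed term, target weight times incoming mass, of a squared degree.\<close>

definition paths :: real where
  "paths = expect (\<lambda>a b c. of_bool (E b a \<and> E c b) + of_bool (E c b \<and> E a c) + of_bool (E a c \<and> E b a))"

definition total :: "real \<Rightarrow> real \<Rightarrow> real \<Rightarrow> real" where
  "total \<alpha> \<beta> \<gamma> = (\<Sum>b\<in>B. excess \<alpha> (s b) (out A b)) + (\<Sum>c\<in>C. excess \<beta> (s c) (out B c))
     + (\<Sum>a\<in>A. excess \<gamma> (s a) (out C a))"

text \<open>The hypotheses are invariant under the cyclic shift, so \<open>total_paths_arc\<close>
  also covers the other two positions of the present and the missing arc.\<close>

lemma rotate: "cyclic_triple B C A s E"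
  using finite_A finite_B finite_C nonneg sum_A sum_B sum_C unique_BA unique_CB unique_AC no_triangle
  by unfold_locales blast+

lemma expect_mono:
  assumes "\<And>a b c. a \<in> A \<Longrightarrow> b \<in> B \<Longrightarrow> c \<in> C \<Longrightarrow> F a b c \<le> G a b c"
  shows "expect F \<le> expect G"
  unfolding expect_def using assms nonneg by (intro sum_mono mult_left_mono) auto

lemma expect_add: "expect (\<lambda>a b c. F a b c + G a b c) = expect F + expect G"
  unfolding expect_def by (simp add: algebra_simps sum.distrib)

lemma expect_cmult: "expect (\<lambda>a b c. k * F a b c) = k * expect F"
  unfolding expect_def by (simp add: sum_distrib_left mult.left_commute)

lemma expect_BA: "expect (\<lambda>a b c. of_bool (E b a)) = (\<Sum>b\<in>B. s b * out A b)"
proof -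
  have "expect (\<lambda>a b c. of_bool (E b a)) = (\<Sum>a\<in>A. \<Sum>b\<in>B. s a * s b * of_bool (E b a))"
    unfolding expect_def
    by (intro sum.cong refl) (simp add: sum_distrib_left[symmetric] sum_distrib_right[symmetric] sum_C)
  also have "\<dots> = (\<Sum>b\<in>B. s b * out A b)"
    unfolding out_def sum_distrib_left by (subst sum.swap) (simp add: mult.assoc mult.left_commute)
  finally show ?thesis .
qed

lemma expect_CB: "expect (\<lambda>a b c. of_bool (E c b)) = (\<Sum>c\<in>C. s c * out B c)"
proof -
  have "expect (\<lambda>a b c. of_bool (E c b)) = (\<Sum>b\<in>B. \<Sum>c\<in>C. s b * s c * of_bool (E c b))"
    unfolding expect_def
    by (simp add: mult.assoc sum_distrib_left[symmetric] sum_distrib_right[symmetric] sum_A)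
  also have "\<dots> = (\<Sum>c\<in>C. s c * out B c)"
    unfolding out_def sum_distrib_left by (subst sum.swap) (simp add: mult.assoc mult.left_commute)
  finally show ?thesis .
qed

lemma expect_AC: "expect (\<lambda>a b c. of_bool (E a c)) = (\<Sum>a\<in>A. s a * out C a)"
proof -
  have "expect (\<lambda>a b c. of_bool (E a c))
      = (\<Sum>a\<in>A. \<Sum>b\<in>B. s b * (s a * (\<Sum>c\<in>C. s c * of_bool (E a c))))"
    unfolding expect_def sum_distrib_left by (simp add: mult.assoc mult.left_commute)
  also have "\<dots> = (\<Sum>a\<in>A. s a * out C a)"
    unfolding sum_distrib_right[symmetric] sum_B out_def by simp
  finally show ?thesis .
qed

lemma sum_excess_shift:
  "(\<Sum>v\<in>T. excess k (s v) (f v)) = (\<Sum>v\<in>T. excess 5 (s v) (f v)) + (k - 5) * (\<Sum>v\<in>T. s v * f v)"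
  unfolding sum_distrib_left sum.distrib[symmetric]
  by (intro sum.cong refl) (simp add: excess_def algebra_simps)

text \<open>At most two of the three arcs are present on a triple, so the number of pairs of arcs is
  at most half the number of arcs, and also at most the number of arcs of two fixed kinds.\<close>

lemma paths_le_total:
  assumes "(\<alpha>, \<beta>, \<gamma>) \<in> {(6, 6, 6), (7, 5, 7), (5, 7, 7)}"
  shows "total 5 5 5 + 2 * paths \<le> total \<alpha> \<beta> \<gamma>"
proof -
  have "2 * paths \<le> expect (\<lambda>a b c. (\<alpha> - 5) * of_bool (E b a) + (\<beta> - 5) * of_bool (E c b)
      + (\<gamma> - 5) * of_bool (E a c))"
    unfolding paths_def expect_cmult[symmetric]
    using assms no_triangle by (intro expect_mono) (auto simp: of_bool_def)
  also have "\<dots> = total \<alpha> \<beta> \<gamma> - total 5 5 5"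
    unfolding expect_add expect_cmult expect_BA expect_CB expect_AC total_def
      sum_excess_shift[of \<alpha>] sum_excess_shift[of \<beta>] sum_excess_shift[of \<gamma>] by simp
  finally show ?thesis by linarith
qed

end

text \<open>The right-hand side has the form \<open>2 + H p - H r\<close>, which telescopes around the cycle.\<close>

lemma no_arcs_pair:
  fixes p r w :: real
  assumes "0 \<le> p" "p \<le> 1" "0 \<le> w" "w \<le> r" "w \<le> 1 - r"
  shows "p * (w * (6 - 2 * p - w)) - p^2 * (2 - p) + (1 - p) * (r * (6 - r)) - w^2 * (2 - w)
    \<le> 2 - 4 * p + p^2 + 4 * r - r^2"
proof -
  have "0 \<le> 2 - 4 * p + p^2 + 4 * r - r^2
      - (p * w * (6 - 2 * p - w) + (1 - p) * r * (6 - r) - w^2 * (2 - w) - p^2 * (2 - p))"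
    using assms by (intro no_arcs_nonneg) auto
  then show ?thesis by (simp add: mult.assoc)
qed

section \<open>Estimates through the heaviest vertices\<close>

context cyclic_triple
begin

lemma out_cases:
  assumes "finite T" "\<And>w w'. w \<in> T \<Longrightarrow> w' \<in> T \<Longrightarrow> E v w \<Longrightarrow> E v w' \<Longrightarrow> w = w'"
  obtains (none) "\<And>w. w \<in> T \<Longrightarrow> \<not> E v w" "out T v = 0"
  | (one) w where "w \<in> T" "E v w" "out T v = s w"
proof (cases "\<exists>w\<in>T. E v w")
  case False
  then show ?thesis
    by (intro none) (auto simp: out_def intro!: sum.neutral)
next
  case True
  then obtain w where w: "w \<in> T" "E v w" by auto
  have "out T v = (\<Sum>w'\<in>T. if w' = w then s w else 0)"
    unfolding out_def using assms(2) w by (intro sum.cong) (auto simp: of_bool_def)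
  then show ?thesis
    using w assms(1) by (intro one[of w]) auto
qed

lemma out_nonneg: "0 \<le> out T v"
  unfolding out_def using nonneg by (intro sum_nonneg) auto

lemma two_le_1:
  assumes "finite T" "sum s T = 1" "v \<in> T" "w \<in> T" "v \<noteq> w"
  shows "s v + s w \<le> 1"
  using sum_mono2[of T "{v, w}" s] assms nonneg by simp

lemma weight_le_1:
  assumes "finite T" "sum s T = 1" "v \<in> T"
  shows "s v \<le> 1"
  using member_le_sum[of v T s] assms nonneg by simp

definition heaviest :: "'v set \<Rightarrow> 'v \<Rightarrow> bool" where
  "heaviest T v \<longleftrightarrow> v \<in> T \<and> (\<forall>w\<in>T. s w \<le> s v)"

lemma heaviest_exists:
  assumes "finite T" "sum s T = 1"
  obtains v where "heaviest T v"
proof -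
  have "T \<noteq> {}" using assms(2) by auto
  with assms(1) have "Max (s ` T) \<in> s ` T" by simp
  then obtain v where "v \<in> T" "s v = Max (s ` T)" by auto
  then show ?thesis
    using assms(1) by (intro that[of v]) (auto simp: heaviest_def)
qed

lemma out_le_heaviest:
  assumes "finite T" "\<And>w w'. w \<in> T \<Longrightarrow> w' \<in> T \<Longrightarrow> E v w \<Longrightarrow> E v w' \<Longrightarrow> w = w'" "heaviest T t0"
  shows "out T v \<le> s t0"
  using assms(3) nonneg by (cases rule: out_cases[OF assms(1,2)]) (auto simp: heaviest_def)

text \<open>The target differs from \<open>t0\<close>, and two vertices of a part of mass
  \<open>1\<close> weigh at most \<open>1\<close> together.\<close>

lemma out_avoiding:
  assumes "finite T" "sum s T = 1" "\<And>w w'. w \<in> T \<Longrightarrow> w' \<in> T \<Longrightarrow> E v w \<Longrightarrow> E v w' \<Longrightarrow> w = w'"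
    and "heaviest T t0" "\<not> E v t0"
  shows "out T v \<le> 1 - s t0"
    and "out T v = 0 \<or> (\<exists>w\<in>T. w \<noteq> t0 \<and> E v w \<and> s w = out T v)"
proof -
  have t0: "t0 \<in> T" using assms(4) by (simp add: heaviest_def)
  note * = out_cases[OF assms(1,3)]
  show "out T v = 0 \<or> (\<exists>w\<in>T. w \<noteq> t0 \<and> E v w \<and> s w = out T v)"
    using assms(5) by (cases rule: *) auto
  then show "out T v \<le> 1 - s t0"
  proof (elim disjE bexE conjE)
    fix w assume "w \<in> T" "w \<noteq> t0" "s w = out T v"
    then show ?thesis using two_le_1[OF assms(1,2) t0, of w] by auto
  qed (use weight_le_1[OF assms(1,2) t0] in simp)
qed

text \<open>In use, \<open>x\<close> is the weight of the vertex of \<open>T\<close> to which the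
  heaviest vertex of the following part points. Its loss \<open>x^2 * (2 - x)\<close> is kept to be
  paired with the terms of that heaviest vertex.\<close>

lemma no_arcs_part:
  assumes T: "finite T" "sum s T = 1" and R: "finite R" "sum s R = 1"
    and unique: "\<And>v w w'. v \<in> T \<Longrightarrow> w \<in> R \<Longrightarrow> w' \<in> R \<Longrightarrow> E v w \<Longrightarrow> E v w' \<Longrightarrow> w = w'"
    and t0: "heaviest T t0" and r0: "heaviest R r0"
    and x: "x = 0 \<or> (\<exists>t\<in>T. t \<noteq> t0 \<and> s t = x)"
  shows "(\<Sum>t\<in>T. excess 6 (s t) (out R t)) \<le> s t0 * (out R t0 * (6 - 2 * s t0 - out R t0))
    - (s t0)^2 * (2 - s t0) + (1 - s t0) * (s r0 * (6 - s r0)) - x^2 * (2 - x)"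
proof -
  have t0T: "t0 \<in> T" and r0R: "r0 \<in> R" using t0 r0 by (auto simp: heaviest_def)
  have le: "out R t \<le> s r0" if "t \<in> T" for t
    using that unique R r0 by (intro out_le_heaviest) auto
  have "0 \<le> x"
    using x nonneg by auto
  have "(\<Sum>t\<in>T. excess 6 (s t) (out R t)) \<le> excess 6 (s t0) (out R t0) + excess 6 x (s r0)
      + (1 - s t0 - x) * (s r0 * (6 - s r0))"
    using T le nonneg out_nonneg weight_le_1[OF R r0R] t0T x order_trans[OF le[OF t0T] weight_le_1[OF R r0R]]
    by (intro sum_excess_le) auto
  moreover have "0 \<le> x * (x * s r0)"
    using \<open>0 \<le> x\<close> nonneg by simp
  ultimately show ?thesis
    by (simp add: excess_def algebra_simps power2_eq_square)
qed

text \<open>The loss kept for a target is moved to the part of its source, where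
  \<open>no_arcs_pair\<close> applies; the three right-hand sides then add up to
  \<open>6\<close>.\<close>

lemma total_no_arcs:
  assumes "heaviest A a0" "heaviest B b0" "heaviest C c0"
    and "\<not> E b0 a0" "\<not> E c0 b0" "\<not> E a0 c0"
  shows "total 6 6 6 \<le> 6"
proof -
  have in': "a0 \<in> A" "b0 \<in> B" "c0 \<in> C" using assms by (auto simp: heaviest_def)
  note le1 = weight_le_1[OF finite_A sum_A in'(1)] weight_le_1[OF finite_B sum_B in'(2)]
    weight_le_1[OF finite_C sum_C in'(3)]
  note BA = out_avoiding[OF finite_A sum_A unique_BA[OF in'(2)] assms(1,4)]
    and CB = out_avoiding[OF finite_B sum_B unique_CB[OF in'(3)] assms(2,5)]
    and AC = out_avoiding[OF finite_C sum_C unique_AC[OF in'(1)] assms(3,6)]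
  have leh: "out A b0 \<le> s a0" "out B c0 \<le> s b0" "out C a0 \<le> s c0"
    using out_le_heaviest[OF finite_A unique_BA[OF in'(2)] assms(1)]
      out_le_heaviest[OF finite_B unique_CB[OF in'(3)] assms(2)]
      out_le_heaviest[OF finite_C unique_AC[OF in'(1)] assms(3)] by blast+
  have "(\<Sum>b\<in>B. excess 6 (s b) (out A b)) \<le> s b0 * (out A b0 * (6 - 2 * s b0 - out A b0))
    - (s b0)^2 * (2 - s b0) + (1 - s b0) * (s a0 * (6 - s a0)) - (out B c0)^2 * (2 - out B c0)"
    by (rule no_arcs_part[OF finite_B sum_B finite_A sum_A unique_BA assms(2) assms(1)])
      (use CB(2) in auto)
  moreover have "(\<Sum>c\<in>C. excess 6 (s c) (out B c)) \<le> s c0 * (out B c0 * (6 - 2 * s c0 - out B c0))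
    - (s c0)^2 * (2 - s c0) + (1 - s c0) * (s b0 * (6 - s b0)) - (out C a0)^2 * (2 - out C a0)"
    by (rule no_arcs_part[OF finite_C sum_C finite_B sum_B unique_CB assms(3) assms(2)])
      (use AC(2) in auto)
  moreover have "(\<Sum>a\<in>A. excess 6 (s a) (out C a)) \<le> s a0 * (out C a0 * (6 - 2 * s a0 - out C a0))
    - (s a0)^2 * (2 - s a0) + (1 - s a0) * (s c0 * (6 - s c0)) - (out A b0)^2 * (2 - out A b0)"
    by (rule no_arcs_part[OF finite_A sum_A finite_C sum_C unique_AC assms(1) assms(3)])
      (use BA(2) in auto)
  moreover note no_arcs_pair[OF nonneg le1(2) out_nonneg leh(1) BA(1)]
    no_arcs_pair[OF nonneg le1(3) out_nonneg leh(2) CB(1)]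
    no_arcs_pair[OF nonneg le1(1) out_nonneg leh(3) AC(1)]
  ultimately show ?thesis
    unfolding total_def by linarith
qed

text \<open>For \<open>c0\<close> only \<open>out B c0 \<le> s b0\<close> enters, which covers both
  answers to whether \<open>c0\<close> points to \<open>b0\<close>. A weight \<open>0\<close> also
  encodes that the walk from \<open>a0\<close> has stopped.\<close>

lemma total_one_missing_arc:
  assumes hv: "heaviest A a0" "heaviest B b0" "heaviest C c0" and "E b0 a0" "\<not> E a0 c0"
  obtains \<alpha> \<beta> \<gamma> where "(\<alpha>, \<beta>, \<gamma>) \<in> {(6, 6, 6), (7, 5, 7), (5, 7, 7)}" "total \<alpha> \<beta> \<gamma> \<le> 6"
proof -
  have in': "a0 \<in> A" "b0 \<in> B" "c0 \<in> C" using hv by (auto simp: heaviest_def)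
  note le1 = weight_le_1[OF finite_A sum_A in'(1)] weight_le_1[OF finite_B sum_B in'(2)]
    weight_le_1[OF finite_C sum_C in'(3)]
  have leA: "out A b \<le> s a0" if "b \<in> B" for b
    using out_le_heaviest[OF finite_A unique_BA[OF that] hv(1)] by blast
  have leB: "out B c \<le> s b0" if "c \<in> C" for c
    using out_le_heaviest[OF finite_B unique_CB[OF that] hv(2)] by blast
  have leC: "out C a \<le> s c0" if "a \<in> A" for a
    using out_le_heaviest[OF finite_C unique_AC[OF that] hv(3)] by blast
  note AC = out_avoiding[OF finite_C sum_C unique_AC[OF in'(1)] hv(3) assms(5)]
  define w where "w = out C a0"
  obtain g where g: "w = 0 \<or> (\<exists>c\<in>C. c \<noteq> c0 \<and> s c = w \<and> out B c \<le> g)" "0 \<le> g" "g \<le> s b0" "g \<le> 1 - s b0"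
    "g = 0 \<or> (\<exists>b\<in>B. b \<noteq> b0 \<and> s b = g \<and> \<not> E b a0)"
  proof (cases "w = 0")
    case True
    then show ?thesis
      using that[of 0] nonneg le1 by auto
  next
    case False
    then obtain c where c: "c \<in> C" "c \<noteq> c0" "E a0 c" "s c = w"
      using AC(2) unfolding w_def by auto
    \<comment> \<open>Otherwise \<open>b0\<close>, \<open>a0\<close>, \<open>c\<close> would close a
      3-cycle. The same argument keeps the target of \<open>c\<close> from pointing to
      \<open>a0\<close>, which later gives \<open>h \<le> 1 - s a0\<close>.\<close>
    have "\<not> E c b0"
      using no_triangle[OF in'(1,2) c(1) assms(4)] c(3) by blast
    note CB = out_avoiding[OF finite_B sum_B unique_CB[OF c(1)] hv(2) this]
    have "out B c = 0 \<or> (\<exists>b\<in>B. b \<noteq> b0 \<and> s b = out B c \<and> \<not> E b a0)"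
      using CB(2) no_triangle[OF in'(1) _ c(1)] c(3) by blast
    then show ?thesis
      using that[of "out B c"] c CB(1) leB[OF c(1)] out_nonneg by auto
  qed
  obtain h where h: "g = 0 \<or> (\<exists>b\<in>B. b \<noteq> b0 \<and> s b = g \<and> out A b \<le> h)" "0 \<le> h" "h \<le> s a0" "h \<le> 1 - s a0"
  proof (cases "g = 0")
    case True
    then show ?thesis
      using that[of 0] nonneg le1 by auto
  next
    case False
    with g(5) obtain b where b: "b \<in> B" "b \<noteq> b0" "s b = g" "\<not> E b a0" by auto
    then show ?thesis
      using that[of "out A b"] out_avoiding(1)[OF finite_A sum_A unique_BA[OF b(1)] hv(1) b(4)]
        leA[OF b(1)] out_nonneg by auto
  qed
  have w: "0 \<le> w" "w \<le> s c0" "w \<le> 1 - s c0"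
    using AC(1) leC[OF in'(1)] out_nonneg by (auto simp: w_def)
  obtain \<alpha> \<beta> \<gamma> where k: "(\<alpha>, \<beta>, \<gamma>) \<in> {(6, 6, 6), (7, 5, 7), (5, 7, 7)}" and
    bound: "excess \<gamma> (s a0) w + (1 - s a0) * (s c0 * (\<gamma> - s c0))
     + excess \<alpha> (s b0) (s a0) + excess \<alpha> g h + (1 - s b0 - g) * (s a0 * (\<alpha> - s a0))
     + excess \<beta> (s c0) (s b0) + excess \<beta> w g + (1 - s c0 - w) * (s b0 * (\<beta> - s b0)) \<le> 6"
    by (rule one_missing_arc[of "s a0" "s b0" w "s c0" g h]) (use nonneg le1 w g h in auto)
  have k5: "5 \<le> \<alpha>" "5 \<le> \<beta>" "5 \<le> \<gamma>" using k by auto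
  \<comment> \<open>In \<open>A\<close> only \<open>a0\<close> receives an individual bound, so the
    optional vertex of \<open>sum_excess_le\<close> has weight \<open>0\<close>.\<close>
  have "(\<Sum>a\<in>A. excess \<gamma> (s a) (out C a)) \<le> excess \<gamma> (s a0) w + excess \<gamma> 0 0
      + (1 - s a0 - 0) * (s c0 * (\<gamma> - s c0))"
    by (rule sum_excess_le[OF finite_A nonneg sum_A out_nonneg leC le1(3) k5(3) in'(1)])
      (use w le1(3) in \<open>auto simp: w_def[symmetric]\<close>)
  moreover have "(\<Sum>b\<in>B. excess \<alpha> (s b) (out A b)) \<le> excess \<alpha> (s b0) (s a0) + excess \<alpha> g h
      + (1 - s b0 - g) * (s a0 * (\<alpha> - s a0))"
    using finite_B sum_B nonneg out_nonneg leA le1 k5 in' h by (intro sum_excess_le) auto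
  moreover have "(\<Sum>c\<in>C. excess \<beta> (s c) (out B c)) \<le> excess \<beta> (s c0) (s b0) + excess \<beta> w g
      + (1 - s c0 - w) * (s b0 * (\<beta> - s b0))"
    using finite_C sum_C nonneg out_nonneg leB le1 k5 in' g by (intro sum_excess_le) auto
  ultimately have "total \<alpha> \<beta> \<gamma> \<le> 6"
    using bound unfolding total_def by (simp add: excess_def[of _ 0])
  with k that show thesis by blast
qed

lemma total_paths_arc:
  assumes "heaviest A a0" "heaviest B b0" "heaviest C c0" and "E b0 a0" "\<not> E a0 c0"
  shows "total 5 5 5 + 2 * paths \<le> 6"
proof -
  obtain \<alpha> \<beta> \<gamma> where "(\<alpha>, \<beta>, \<gamma>) \<in> {(6, 6, 6), (7, 5, 7), (5, 7, 7)}" "total \<alpha> \<beta> \<gamma> \<le> 6"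
    by (rule total_one_missing_arc[OF assms])
  then show ?thesis
    using paths_le_total[of \<alpha> \<beta> \<gamma>] by linarith
qed

lemma expect_rotate: "cyclic_triple.expect B C A s F = expect (\<lambda>a b c. F b c a)"
proof -
  interpret rot: cyclic_triple B C A s E by (rule rotate)
  have "rot.expect F = (\<Sum>b\<in>B. \<Sum>a\<in>A. \<Sum>c\<in>C. s b * s c * s a * F b c a)"
    unfolding rot.expect_def by (rule sum.cong[OF refl sum.swap])
  also have "\<dots> = (\<Sum>a\<in>A. \<Sum>b\<in>B. \<Sum>c\<in>C. s b * s c * s a * F b c a)"
    by (rule sum.swap)
  finally show ?thesis
    unfolding expect_def by (simp add: mult_ac)
qed

lemma paths_rotate: "cyclic_triple.paths B C A s E = paths"
proof -
  interpret rot: cyclic_triple B C A s E by (rule rotate)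
  show ?thesis
    unfolding rot.paths_def paths_def expect_rotate by (simp add: add_ac conj_commute)
qed

lemma total_rotate: "cyclic_triple.total B C A s E k k k = total k k k"
proof -
  interpret rot: cyclic_triple B C A s E by (rule rotate)
  show ?thesis
    unfolding rot.total_def total_def by simp
qed

theorem total_paths_le: "total 5 5 5 + 2 * paths \<le> 6"
proof -
  interpret rot: cyclic_triple B C A s E by (rule rotate)
  interpret rot2: cyclic_triple C A B s E by (rule rot.rotate)
  obtain a0 b0 c0 where hv: "heaviest A a0" "heaviest B b0" "heaviest C c0"
    using heaviest_exists[OF finite_A sum_A] heaviest_exists[OF finite_B sum_B]
      heaviest_exists[OF finite_C sum_C] by metis
  then have "\<not> (E b0 a0 \<and> E c0 b0 \<and> E a0 c0)"
    using no_triangle by (auto simp: heaviest_def)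
  \<comment> \<open>Going around the cycle, some present arc is followed by a missing one unless all
    three are missing.\<close>
  then consider "E b0 a0" "\<not> E a0 c0" | "E c0 b0" "\<not> E b0 a0" | "E a0 c0" "\<not> E c0 b0"
    | "\<not> E b0 a0" "\<not> E c0 b0" "\<not> E a0 c0" by blast
  then show ?thesis
  proof cases
    case 1
    then show ?thesis using total_paths_arc hv by blast
  next
    case 2
    then show ?thesis
      using rot.total_paths_arc[of b0 c0 a0] hv by (simp add: paths_rotate total_rotate)
  next
    case 3
    then show ?thesis
      using rot2.total_paths_arc[of c0 a0 b0] hv
      by (simp add: paths_rotate total_rotate rot.paths_rotate rot.total_rotate)
  next
    case 4
    then show ?thesis
      using total_no_arcs[OF hv] paths_le_total[of 6 6 6] by simp
  qed
qed

end

section \<open>Reducing squared degrees to arc terms\<close>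

context cyclic_triple
begin

lemma out_le_1:
  assumes "finite T" "sum s T = 1"
  shows "out T v \<le> 1"
proof -
  have "out T v \<le> sum s T"
    unfolding out_def using nonneg by (intro sum_mono) (auto simp: of_bool_def)
  with assms show ?thesis by simp
qed

text \<open>Double counting of arcs, grouped by source instead of by target: a source
  \<open>q\<close> has at most one target, and its weight is \<open>out T q\<close>.\<close>

lemma sum_in_mass:
  assumes "finite T" "\<And>q t t'. q \<in> Q \<Longrightarrow> t \<in> T \<Longrightarrow> t' \<in> T \<Longrightarrow> E q t \<Longrightarrow> E q t' \<Longrightarrow> t = t'"
    and sym: "\<And>t q. t \<in> T \<Longrightarrow> q \<in> Q \<Longrightarrow> E t q = E q t"
  shows "(\<Sum>t\<in>T. s t * ((3 - 2 * s t) * out Q t)) = (\<Sum>q\<in>Q. s q * (out T q * (3 - 2 * out T q)))"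
proof -
  have "(\<Sum>t\<in>T. s t * ((3 - 2 * s t) * out Q t))
      = (\<Sum>t\<in>T. \<Sum>q\<in>Q. s q * (s t * (3 - 2 * s t) * of_bool (E q t)))"
    unfolding out_def sum_distrib_left using sym by (intro sum.cong) (auto simp: mult_ac)
  also have "\<dots> = (\<Sum>q\<in>Q. s q * (\<Sum>t\<in>T. s t * (3 - 2 * s t) * of_bool (E q t)))"
    by (subst sum.swap) (simp add: sum_distrib_left)
  also have "\<dots> = (\<Sum>q\<in>Q. s q * (out T q * (3 - 2 * out T q)))"
  proof (intro sum.cong refl arg_cong2[where f = "(*)"])
    fix q assume q: "q \<in> Q"
    note unique = assms(2)[OF q]
    show "(\<Sum>t\<in>T. s t * (3 - 2 * s t) * of_bool (E q t)) = out T q * (3 - 2 * out T q)"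
    proof (rule out_cases[OF assms(1) unique])
      assume "\<And>t. t \<in> T \<Longrightarrow> \<not> E q t" "out T q = 0"
      then show ?thesis by simp
    next
      fix t assume one: "t \<in> T" "E q t" "out T q = s t"
      have "(\<Sum>t\<in>T. s t * (3 - 2 * s t) * of_bool (E q t))
          = (\<Sum>t'\<in>T. if t' = t then s t * (3 - 2 * s t) else 0)"
        using unique one by (intro sum.cong) (auto simp: of_bool_def)
      then show ?thesis using one assms(1) by simp
    qed auto
  qed
  finally show ?thesis .
qed

text \<open>With \<open>I = out Q t\<close>, the terms \<open>2 * (1 - s t) * I + I^2\<close> are at
  most \<open>(3 - 2 * s t) * I\<close> because \<open>I \<le> 1\<close>; \<open>sum_in_mass\<close>
  then charges them to the sources in \<open>Q\<close>.\<close>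

lemma degree_part_le:
  assumes T: "finite T" and Q: "finite Q" "sum s Q = 1"
    and unique: "\<And>q t t'. q \<in> Q \<Longrightarrow> t \<in> T \<Longrightarrow> t' \<in> T \<Longrightarrow> E q t \<Longrightarrow> E q t' \<Longrightarrow> t = t'"
    and sym: "\<And>t q. t \<in> T \<Longrightarrow> q \<in> Q \<Longrightarrow> E t q = E q t"
  shows "(\<Sum>t\<in>T. s t * (1 - s t + out R t + out Q t)^2)
    \<le> (\<Sum>t\<in>T. s t * ((1 - s t)^2 + 2 * (1 - s t) * out R t + (out R t)^2))
      + (\<Sum>q\<in>Q. s q * (out T q * (3 - 2 * out T q))) + 2 * (\<Sum>t\<in>T. s t * (out R t * out Q t))"
proof -
  have "(\<Sum>t\<in>T. s t * (1 - s t + out R t + out Q t)^2)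
      \<le> (\<Sum>t\<in>T. s t * ((1 - s t)^2 + 2 * (1 - s t) * out R t + (out R t)^2)
        + s t * ((3 - 2 * s t) * out Q t) + 2 * (s t * (out R t * out Q t)))"
  proof (intro sum_mono)
    fix t
    have "0 \<le> s t * (out Q t * (1 - out Q t))"
      using nonneg out_nonneg out_le_1[OF Q] by (intro mult_nonneg_nonneg) auto
    then show "s t * (1 - s t + out R t + out Q t)^2
      \<le> s t * ((1 - s t)^2 + 2 * (1 - s t) * out R t + (out R t)^2)
        + s t * ((3 - 2 * s t) * out Q t) + 2 * (s t * (out R t * out Q t))"
      by (simp add: algebra_simps power2_eq_square)
  qed
  moreover have "(\<Sum>t\<in>T. s t * ((3 - 2 * s t) * out Q t)) = (\<Sum>q\<in>Q. s q * (out T q * (3 - 2 * out T q)))"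
    using unique sym by (rule sum_in_mass[OF T])
  ultimately show ?thesis
    by (simp only: sum.distrib sum_distrib_left)
qed

text \<open>After charging to sources, each part contributes \<open>1\<close> plus its sum of
  \<open>excess 5\<close>, and the mixed terms are exactly \<open>2 * paths\<close>;
  \<open>total_paths_le\<close> turns this into \<open>3 + 6\<close>.\<close>

lemma clique_sum_le:
  assumes AB: "\<And>a b. a \<in> A \<Longrightarrow> b \<in> B \<Longrightarrow> E a b = E b a"
    and BC: "\<And>b c. b \<in> B \<Longrightarrow> c \<in> C \<Longrightarrow> E b c = E c b"
    and CA: "\<And>c a. c \<in> C \<Longrightarrow> a \<in> A \<Longrightarrow> E c a = E a c"
  shows "(\<Sum>a\<in>A. s a * (1 - s a + out C a + out B a)^2) + (\<Sum>b\<in>B. s b * (1 - s b + out A b + out C b)^2)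
    + (\<Sum>c\<in>C. s c * (1 - s c + out B c + out A c)^2) \<le> 9"
proof -
  have main: "(\<Sum>t\<in>T. s t * ((1 - s t)^2 + 2 * (1 - s t) * out R t + (out R t)^2))
      + (\<Sum>t\<in>T. s t * (out R t * (3 - 2 * out R t))) = 1 + (\<Sum>t\<in>T. excess 5 (s t) (out R t))"
    if "sum s T = 1" for T R
  proof -
    have "(\<Sum>t\<in>T. s t * ((1 - s t)^2 + 2 * (1 - s t) * out R t + (out R t)^2))
      + (\<Sum>t\<in>T. s t * (out R t * (3 - 2 * out R t))) = (\<Sum>t\<in>T. s t + excess 5 (s t) (out R t))"
      unfolding sum.distrib[symmetric]
      by (intro sum.cong refl) (simp add: excess_def algebra_simps power2_eq_square)
    then show ?thesis
      using that by (simp add: sum.distrib)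
  qed
  have a: "(\<Sum>a\<in>A. s a * (out C a * out B a)) = expect (\<lambda>a b c. of_bool (E a c \<and> E b a))"
  proof -
    have "(\<Sum>a\<in>A. s a * (out C a * out B a))
        = (\<Sum>a\<in>A. \<Sum>c\<in>C. \<Sum>b\<in>B. s a * s b * s c * of_bool (E a c \<and> E b a))"
      unfolding out_def sum_product unfolding sum_distrib_left using AB
      by (intro sum.cong refl) (auto simp: of_bool_def)
    also have "\<dots> = expect (\<lambda>a b c. of_bool (E a c \<and> E b a))"
      unfolding expect_def by (rule sum.cong[OF refl sum.swap])
    finally show ?thesis .
  qed
  have b: "(\<Sum>b\<in>B. s b * (out A b * out C b)) = expect (\<lambda>a b c. of_bool (E b a \<and> E c b))"
  proof -
    have "(\<Sum>b\<in>B. s b * (out A b * out C b))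
        = (\<Sum>b\<in>B. \<Sum>a\<in>A. \<Sum>c\<in>C. s a * s b * s c * of_bool (E b a \<and> E c b))"
      unfolding out_def sum_product unfolding sum_distrib_left using BC
      by (intro sum.cong refl) (auto simp: of_bool_def)
    then show ?thesis
      unfolding expect_def by (subst sum.swap) simp
  qed
  have c: "(\<Sum>c\<in>C. s c * (out B c * out A c)) = expect (\<lambda>a b c. of_bool (E c b \<and> E a c))"
  proof -
    have "(\<Sum>c\<in>C. s c * (out B c * out A c))
        = (\<Sum>c\<in>C. \<Sum>b\<in>B. \<Sum>a\<in>A. s a * s b * s c * of_bool (E c b \<and> E a c))"
      unfolding out_def sum_product unfolding sum_distrib_left using CA
      by (intro sum.cong refl) (auto simp: of_bool_def)
    also have "\<dots> = (\<Sum>b\<in>B. \<Sum>c\<in>C. \<Sum>a\<in>A. s a * s b * s c * of_bool (E c b \<and> E a c))"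
      by (rule sum.swap)
    also have "\<dots> = (\<Sum>b\<in>B. \<Sum>a\<in>A. \<Sum>c\<in>C. s a * s b * s c * of_bool (E c b \<and> E a c))"
      by (rule sum.cong[OF refl sum.swap])
    also have "\<dots> = expect (\<lambda>a b c. of_bool (E c b \<and> E a c))"
      unfolding expect_def by (rule sum.swap)
    finally show ?thesis .
  qed
  define self where "self T R = (\<Sum>t\<in>T. s t * ((1 - s t)^2 + 2 * (1 - s t) * out R t + (out R t)^2))" for T R
  define inm where "inm Q T = (\<Sum>q\<in>Q. s q * (out T q * (3 - 2 * out T q)))" for Q T
  have "(\<Sum>a\<in>A. s a * (1 - s a + out C a + out B a)^2)
      \<le> self A C + inm B A + 2 * (\<Sum>a\<in>A. s a * (out C a * out B a))"
    unfolding self_def inm_def using unique_BA AB by (rule degree_part_le[OF finite_A finite_B sum_B])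
  moreover have "(\<Sum>b\<in>B. s b * (1 - s b + out A b + out C b)^2)
      \<le> self B A + inm C B + 2 * (\<Sum>b\<in>B. s b * (out A b * out C b))"
    unfolding self_def inm_def using unique_CB BC by (rule degree_part_le[OF finite_B finite_C sum_C])
  moreover have "(\<Sum>c\<in>C. s c * (1 - s c + out B c + out A c)^2)
      \<le> self C B + inm A C + 2 * (\<Sum>c\<in>C. s c * (out B c * out A c))"
    unfolding self_def inm_def using unique_AC CA by (rule degree_part_le[OF finite_C finite_A sum_A])
  moreover have "(\<Sum>b\<in>B. excess 5 (s b) (out A b)) + (\<Sum>c\<in>C. excess 5 (s c) (out B c))
      + (\<Sum>a\<in>A. excess 5 (s a) (out C a)) + 2 * ((\<Sum>b\<in>B. s b * (out A b * out C b))
      + (\<Sum>c\<in>C. s c * (out B c * out A c)) + (\<Sum>a\<in>A. s a * (out C a * out B a))) \<le> 6"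
    using total_paths_le unfolding total_def paths_def expect_add a b c .
  ultimately show ?thesis
    using main[OF sum_A, of C, folded self_def inm_def] main[OF sum_B, of A, folded self_def inm_def]
      main[OF sum_C, of B, folded self_def inm_def] by argo
qed

end

section \<open>Weighted graphs with forbidden triangles\<close>

definition wdeg :: "('v \<Rightarrow> real) \<Rightarrow> ('v \<Rightarrow> 'v \<Rightarrow> bool) \<Rightarrow> 'v set \<Rightarrow> 'v \<Rightarrow> real" where
  "wdeg x e U v = (\<Sum>w\<in>U. x w * of_bool (e v w))"

definition wnorm :: "('v \<Rightarrow> real) \<Rightarrow> ('v \<Rightarrow> 'v \<Rightarrow> bool) \<Rightarrow> 'v set \<Rightarrow> real" where
  "wnorm x e U = (\<Sum>v\<in>U. x v * (wdeg x e U v)^2)"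

text \<open>Apart from \<open>(1, 2, 3)\<close> these are the types \<open>(i, i, i + 1)\<close>
  modulo 3: they forbid that the ends of an edge inside a part have a common neighbour in the
  following part.\<close>

definition bad_types :: "(3 \<times> 3 \<times> 3) set" where
  "bad_types = {(1, 2, 3), (1, 1, 2), (2, 2, 3), (3, 3, 1)}"

definition admissible :: "('v \<Rightarrow> 3) \<Rightarrow> ('v \<Rightarrow> 'v \<Rightarrow> bool) \<Rightarrow> 'v set \<Rightarrow> bool" where
  "admissible \<pi> e U \<longleftrightarrow> (\<forall>u\<in>U. \<forall>v\<in>U. e u v \<longrightarrow> e v u) \<and> (\<forall>u\<in>U. \<not> e u u) \<and>
    (\<forall>u\<in>U. \<forall>v\<in>U. \<forall>w\<in>U. (\<pi> u, \<pi> v, \<pi> w) \<in> bad_types \<longrightarrow> \<not> (e u v \<and> e v w \<and> e u w))"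

text \<open>Two neighbours of a vertex in the preceding part would be adjacent and form a triangle
  of a forbidden type with it; this gives the uniqueness required by \<open>cyclic_triple\<close>.
  Within its own part a vertex has degree \<open>1 - x v\<close>.\<close>

lemma wnorm_le_clique:
  fixes \<pi> :: "'v \<Rightarrow> 3"
  assumes U: "finite U" and x: "\<And>v. 0 \<le> x v" and sums: "\<And>i. sum x {v\<in>U. \<pi> v = i} = 1"
    and adm: "admissible \<pi> e U"
    and clique: "\<And>u v. u \<in> U \<Longrightarrow> v \<in> U \<Longrightarrow> \<pi> u = \<pi> v \<Longrightarrow> u \<noteq> v \<Longrightarrow> e u v"
  shows "wnorm x e U \<le> 9"
proof -
  define P where "P i = {v\<in>U. \<pi> v = i}" for i
  have sym: "e u v \<Longrightarrow> e v u" and irr: "\<not> e u u" if "u \<in> U" "v \<in> U" for u v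
    using adm that unfolding admissible_def by blast+
  have bad: "\<not> (e u v \<and> e v w \<and> e u w)"
    if "u \<in> U" "v \<in> U" "w \<in> U" "(\<pi> u, \<pi> v, \<pi> w) \<in> bad_types" for u v w
    using adm that unfolding admissible_def by blast
  have P: "finite (P i)" "sum x (P i) = 1" for i
    using U sums by (auto simp: P_def)
  have unique: "w = w'" if "v \<in> P j" "w \<in> P i" "w' \<in> P i" "e v w" "e v w'" "(i, i, j) \<in> bad_types"
    for v w w' i j
  proof (rule ccontr)
    assume "w \<noteq> w'"
    have in': "v \<in> U" "w \<in> U" "w' \<in> U" and part: "\<pi> v = j" "\<pi> w = i" "\<pi> w' = i"
      using that(1-3) by (simp_all add: P_def)
    have "e w w'"
      using clique[OF in'(2,3)] part \<open>w \<noteq> w'\<close> by simp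
    moreover have "e w v" "e w' v"
      using sym[OF in'(1,2)] sym[OF in'(1,3)] that(4,5) by simp_all
    ultimately show False
      using bad[OF in'(2,3,1)] part that(6) by simp
  qed
  interpret cyclic_triple "P 1" "P 2" "P 3" x e
  proof
    show "w = w'" if "v \<in> P 2" "w \<in> P 1" "w' \<in> P 1" "e v w" "e v w'" for v w w'
      using unique[OF that] by (simp add: bad_types_def)
    show "w = w'" if "v \<in> P 3" "w \<in> P 2" "w' \<in> P 2" "e v w" "e v w'" for v w w'
      using unique[OF that] by (simp add: bad_types_def)
    show "w = w'" if "v \<in> P 1" "w \<in> P 3" "w' \<in> P 3" "e v w" "e v w'" for v w w'
      using unique[OF that] by (simp add: bad_types_def)
    show False if "a \<in> P 1" "b \<in> P 2" "c \<in> P 3" "e b a" "e c b" "e a c" for a b c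
    proof -
      have in': "a \<in> U" "b \<in> U" "c \<in> U" and part: "\<pi> a = 1" "\<pi> b = 2" "\<pi> c = 3"
        using that(1-3) by (simp_all add: P_def)
      have "e a b" "e b c"
        using sym[OF in'(2,1)] sym[OF in'(3,2)] that(4,5) by simp_all
      then show False
        using bad[OF in'] part that(6) by (simp add: bad_types_def)
    qed
  qed (use P x in auto)
  have U_eq: "U = P 1 \<union> P 2 \<union> P 3"
    using exhaust_3 by (auto simp: P_def)
  have disj: "P 1 \<inter> P 2 = {}" "(P 1 \<union> P 2) \<inter> P 3 = {}"
    by (auto simp: P_def)
  have split: "sum f U = sum f (P 1) + sum f (P 2) + sum f (P 3)" for f :: "'v \<Rightarrow> real"
    unfolding U_eq using P(1) disj by (simp add: sum.union_disjoint)
  have own: "out (P i) v = 1 - x v" if "v \<in> P i" for i v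
  proof -
    have "out (P i) v = (\<Sum>w\<in>P i. x w - (if w = v then x v else 0))"
      unfolding out_def using that clique[of v] irr
      by (intro sum.cong) (auto simp: P_def of_bool_def)
    then show ?thesis
      using that P by (simp add: sum_subtractf)
  qed
  have wdeg: "wdeg x e U v = out (P 1) v + out (P 2) v + out (P 3) v" for v
    unfolding wdeg_def out_def by (rule split)
  have "wnorm x e U = (\<Sum>a\<in>P 1. x a * (1 - x a + out (P 3) a + out (P 2) a)^2)
      + (\<Sum>b\<in>P 2. x b * (1 - x b + out (P 1) b + out (P 3) b)^2)
      + (\<Sum>c\<in>P 3. x c * (1 - x c + out (P 2) c + out (P 1) c)^2)"
    unfolding wnorm_def split wdeg by (simp add: own add_ac)
  also have "\<dots> \<le> 9"
    using sym by (intro clique_sum_le) (auto simp: P_def)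
  finally show ?thesis .
qed

section \<open>Symmetrisation\<close>

text \<open>Moving weight changes degrees by multiples of \<open>\<delta>\<close>, which vanishes at
  \<open>u\<close> and \<open>v\<close>, the only vertices whose weight changes. Hence the cubic
  term disappears and the quadratic coefficient is a weighted sum of squares.\<close>

lemma wnorm_shift:
  assumes "finite U" "u \<in> U" "v \<in> U" "\<not> e u u" "\<not> e v v" "\<not> e u v" "\<not> e v u"
    and x: "\<And>w. 0 \<le> x w"
  obtains L Q where "0 \<le> Q"
    "\<And>t. wnorm (\<lambda>w. x w + t * (of_bool (w = u) - of_bool (w = v))) e U = wnorm x e U + t * L + t^2 * Q"
proof
  define i where "i w = (of_bool (w = u) - of_bool (w = v) :: real)" for w
  define \<delta> where "\<delta> w = (of_bool (e w u) - of_bool (e w v) :: real)" for w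
  show "0 \<le> (\<Sum>w\<in>U. x w * (\<delta> w)^2)"
    using x by (intro sum_nonneg) simp
  have deg: "wdeg (\<lambda>w. x w + t * i w) e U w = wdeg x e U w + t * \<delta> w" for t w
  proof -
    have "(\<Sum>z\<in>U. i z * of_bool (e w z)) = \<delta> w"
      using assms(1-3)
      by (simp add: i_def \<delta>_def left_diff_distrib sum_subtractf of_bool_def if_distrib[of "\<lambda>c. c * _"] cong: if_cong)
    then show ?thesis
      unfolding wdeg_def by (simp add: distrib_right sum.distrib mult.assoc sum_distrib_left[symmetric])
  qed
  define l where "l w = 2 * x w * wdeg x e U w * \<delta> w + i w * (wdeg x e U w)^2" for w
  have i\<delta>: "i w * \<delta> w = 0" for w
    using assms(4-7) by (auto simp: i_def \<delta>_def)
  show "wnorm (\<lambda>w. x w + t * (of_bool (w = u) - of_bool (w = v))) e U = wnorm x e U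
      + t * (\<Sum>w\<in>U. l w) + t^2 * (\<Sum>w\<in>U. x w * (\<delta> w)^2)" for t
  proof -
    have "(x w + t * i w) * (wdeg x e U w + t * \<delta> w)^2 = x w * (wdeg x e U w)^2
        + t * l w + t^2 * (x w * (\<delta> w)^2)" for w
      using i\<delta>[of w] unfolding l_def by algebra
    then have "wnorm (\<lambda>w. x w + t * i w) e U = wnorm x e U
        + t * (\<Sum>w\<in>U. l w) + t^2 * (\<Sum>w\<in>U. x w * (\<delta> w)^2)"
      unfolding wnorm_def deg by (simp only: sum.distrib sum_distrib_left)
    then show ?thesis by (simp add: i_def)
  qed
qed

text \<open>Zykov symmetrisation: moving weight between two nonadjacent vertices is a convex operation.\<close>

lemma wnorm_merge:
  assumes "finite U" "u \<in> U" "v \<in> U" "u \<noteq> v" "\<not> e u u" "\<not> e v v" "\<not> e u v" "\<not> e v u"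
    and x: "\<And>w. 0 \<le> x w"
  shows "wnorm x e U \<le> wnorm (x(u := x u + x v, v := 0)) e U
    \<or> wnorm x e U \<le> wnorm (x(v := x v + x u, u := 0)) e U"
proof -
  obtain L Q where Q: "0 \<le> Q" and shift: "\<And>t. wnorm (\<lambda>w. x w + t * (of_bool (w = u) - of_bool (w = v))) e U
      = wnorm x e U + t * L + t^2 * Q"
    using wnorm_shift[where x = x and e = e, OF assms(1-3,5-8) x] by metis
  have 1: "(\<lambda>w. x w + x v * (of_bool (w = u) - of_bool (w = v))) = x(u := x u + x v, v := 0)"
    using assms(4) by auto
  have 2: "(\<lambda>w. x w + (- x u) * (of_bool (w = u) - of_bool (w = v))) = x(v := x v + x u, u := 0)"
    using assms(4) by auto
  show ?thesis
  \<comment> \<open>The shifts \<open>t = x v\<close> and \<open>t = - x u\<close> empty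
    \<open>v\<close> and \<open>u\<close> respectively; the sign of \<open>L\<close> selects one for
    which the linear term is nonnegative too.\<close>
  proof (cases "0 \<le> L")
    case True
    then have "0 \<le> x v * L + (x v)^2 * Q" using x Q by simp
    then show ?thesis using shift[of "x v"] unfolding 1 by linarith
  next
    case False
    then have "0 \<le> (- x u) * L" using x by (intro mult_nonpos_nonpos) auto
    moreover have "0 \<le> (- x u)^2 * Q" using Q by simp
    ultimately have "0 \<le> (- x u) * L + (- x u)^2 * Q" by linarith
    then show ?thesis using shift[of "- x u"] unfolding 2 by linarith
  qed
qed

lemma wnorm_remove:
  assumes "finite U" "x v = 0"
  shows "wnorm x e U = wnorm x e (U - {v})"
proof -
  have *: "sum f U = sum f (U - {v})" if "f v = 0" for f :: "_ \<Rightarrow> real"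
    using assms(1) that by (cases "v \<in> U") (auto simp: sum.remove)
  have "wdeg x e U = wdeg x e (U - {v})"
    unfolding wdeg_def using assms(2) by (intro ext *) simp
  then show ?thesis
    unfolding wnorm_def using assms(2) by (simp add: *)
qed

text \<open>Induction on the number of vertices: a nonadjacent pair inside a part is merged into one
  of its vertices without decreasing the norm, the emptied vertex is deleted, and
  \<open>wnorm_le_clique\<close> applies when no such pair is left.\<close>

theorem wnorm_le_9:
  fixes \<pi> :: "'v \<Rightarrow> 3"
  assumes "finite U" "\<And>v. 0 \<le> x v" "\<And>i. sum x {v\<in>U. \<pi> v = i} = 1" "admissible \<pi> e U"
  shows "wnorm x e U \<le> 9"
  using assms
proof (induction "card U" arbitrary: U x rule: less_induct)
  case less
  show ?case
  proof (cases "\<forall>u\<in>U. \<forall>v\<in>U. \<pi> u = \<pi> v \<longrightarrow> u \<noteq> v \<longrightarrow> e u v")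
    case True
    then show ?thesis
      using less.prems by (intro wnorm_le_clique) auto
  next
    case False
    then obtain u v where uv: "u \<in> U" "v \<in> U" "\<pi> u = \<pi> v" "u \<noteq> v" "\<not> e u v" by auto
    have e: "\<not> e v u" "\<not> e u u" "\<not> e v v"
      using less.prems(4) uv by (auto simp: admissible_def)
    have step: "wnorm (x(a := x a + x b, b := 0)) e U \<le> 9"
      if ab: "a \<in> U" "b \<in> U" "a \<noteq> b" "\<pi> a = \<pi> b" for a b
    proof -
      let ?x = "x(a := x a + x b, b := 0)"
      have "sum ?x {v\<in>U - {b}. \<pi> v = i} = 1" for i
      proof -
        have fin: "finite {v\<in>U. \<pi> v = i}" using less.prems(1) by simp
        have "sum ?x {v\<in>U - {b}. \<pi> v = i} = (\<Sum>v\<in>{v\<in>U. \<pi> v = i}. ?x v)"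
          using less.prems(1) by (intro sum.mono_neutral_left) auto
        also have "\<dots> = (\<Sum>v\<in>{v\<in>U. \<pi> v = i}. x v + (if v = a then x b else 0) - (if v = b then x b else 0))"
          using ab by (intro sum.cong) auto
        also have "\<dots> = sum x {v\<in>U. \<pi> v = i}"
          using fin ab by (simp add: sum.distrib sum_subtractf)
        finally show ?thesis using less.prems(3) by simp
      qed
      moreover have "admissible \<pi> e (U - {b})"
        using less.prems(4) unfolding admissible_def by blast
      moreover have "card (U - {b}) < card U"
        using less.prems(1) ab by (intro card_Diff1_less) auto
      ultimately have "wnorm ?x e (U - {b}) \<le> 9"
        using less.prems(1,2) by (intro less.hyps) auto
      then show ?thesis
        using wnorm_remove[of U ?x b e] less.prems(1) by simp
    qed
    show ?thesis
      using wnorm_merge[where e = e and x = x, OF less.prems(1) uv(1,2,4) e(2,3) uv(5) e(1) less.prems(2)]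
        step[OF uv(1,2,4,3)] step[OF uv(2,1) uv(4)[symmetric] uv(3)[symmetric]] by linarith
  qed
qed

section \<open>Sampling\<close>

lemma sum_PiE_insert:
  fixes F :: "('i \<Rightarrow> 'a) \<Rightarrow> real"
  assumes "u \<notin> I"
  shows "(\<Sum>f\<in>PiE (insert u I) S. F f) = (\<Sum>a\<in>S u. \<Sum>f\<in>PiE I S. F (f(u := a)))"
proof -
  have "(\<Sum>f\<in>PiE (insert u I) S. F f) = (\<Sum>(a, f)\<in>S u \<times> PiE I S. F (f(u := a)))"
    unfolding PiE_insert_eq using inj_combinator[OF assms, of S]
    by (subst sum.reindex) (auto simp: case_prod_unfold)
  then show ?thesis
    by (simp add: sum.cartesian_product)
qed

text \<open>Three distinct coordinates of a uniform choice function are independent and uniform;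
  denominators are cleared.\<close>

lemma sum_PiE_three:
  fixes G :: "'a \<Rightarrow> 'a \<Rightarrow> 'a \<Rightarrow> real"
  assumes "finite U" "u \<in> U" "v \<in> U" "w \<in> U" "u \<noteq> v" "u \<noteq> w" "v \<noteq> w"
  shows "(\<Sum>f\<in>PiE U S. G (f u) (f v) (f w)) * (card (S u) * card (S v) * card (S w))
    = (\<Sum>a\<in>S u. \<Sum>b\<in>S v. \<Sum>c\<in>S w. G a b c) * card (PiE U S)"
proof -
  let ?R = "U - {u, v, w}"
  have U: "U = insert u (insert v (insert w ?R))" using assms by auto
  have *: "(\<Sum>f\<in>PiE U S. G (f u) (f v) (f w))
      = (\<Sum>a\<in>S u. \<Sum>b\<in>S v. \<Sum>c\<in>S w. G a b c) * card (PiE ?R S)" for G :: "'a \<Rightarrow> 'a \<Rightarrow> 'a \<Rightarrow> real"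
    using assms
    by (subst U) (simp add: sum_PiE_insert sum_distrib_left mult.commute[of _ "real (card (PiE ?R S))"])
  have "real (card (PiE U S)) = card (S u) * card (S v) * card (S w) * card (PiE ?R S)"
    using *[of "\<lambda>_ _ _. 1"] by (simp add: mult.assoc)
  then show ?thesis
    unfolding *[of G] by simp
qed

text \<open>Union bound: each of the three coincidences accounts for \<open>m^2\<close>
  triples.\<close>

lemma distinct_triples:
  "real m ^ 3 - 3 * real m ^ 2 \<le> (\<Sum>a<m. \<Sum>b<m. \<Sum>c<m. of_bool (a \<noteq> b \<and> a \<noteq> c \<and> b \<noteq> c))"
proof -
  have "real m ^ 3 - 3 * real m ^ 2 = (\<Sum>a<m. \<Sum>b<m. real m - 2 - (if b = a then real m else 0))"
    by (simp add: sum_subtractf sum.distrib algebra_simps power3_eq_cube power2_eq_square)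
  also have "\<dots> = (\<Sum>a<m. \<Sum>b<m. \<Sum>c<m. 1 - of_bool (b = a) - of_bool (c = a) - of_bool (c = b))"
    by (intro sum.cong refl) (simp add: sum_subtractf of_bool_def)
  also have "\<dots> \<le> (\<Sum>a<m. \<Sum>b<m. \<Sum>c<m. of_bool (a \<noteq> b \<and> a \<noteq> c \<and> b \<noteq> c))"
    by (intro sum_mono) auto
  finally show ?thesis .
qed

section \<open>Averages over random samples\<close>

locale sampling =
  fixes V :: "'a set" and E :: "'a set set" and P :: "3 \<Rightarrow> 'a set" and m :: nat
  assumes graph: "simple_graph V E" and part: "tripartition V P"
    and nonempty: "\<And>i. P i \<noteq> {}" and m: "0 < m"
begin

definition index :: "(3 \<times> nat) set" where
  "index = UNIV \<times> {..<m}"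

text \<open>Draws are with replacement; a vertex drawn twice gives two nonadjacent copies, as
  \<open>adj\<close> is irreflexive.\<close>

definition samples :: "(3 \<times> nat \<Rightarrow> 'a) set" where
  "samples = PiE index (\<lambda>u. P (fst u))"

definition adj :: "'a \<Rightarrow> 'a \<Rightarrow> bool" where
  "adj a b \<longleftrightarrow> {a, b} \<in> E"

definition sample_norm :: "(3 \<times> nat \<Rightarrow> 'a) \<Rightarrow> real" where
  "sample_norm f = wnorm (\<lambda>_. 1 / real m) (\<lambda>u v. adj (f u) (f v)) index"

text \<open>\<open>b = c\<close> is allowed, so that summing over all parts counts squared degrees
  exactly.\<close>

definition cherries :: "3 \<Rightarrow> 3 \<Rightarrow> 3 \<Rightarrow> real" where
  "cherries i j k = (\<Sum>a\<in>P i. \<Sum>b\<in>P j. \<Sum>c\<in>P k. of_bool (adj a b \<and> adj a c))"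

definition triangles :: "3 \<Rightarrow> 3 \<Rightarrow> 3 \<Rightarrow> real" where
  "triangles i j k = (\<Sum>a\<in>P i. \<Sum>b\<in>P j. \<Sum>c\<in>P k. of_bool (adj a b \<and> adj b c \<and> adj a c))"

definition bad_sets :: "'a set set" where
  "bad_sets = nsets V 3 \<inter> {T. triangle_of_type P E 1 2 3 T \<or> triangle_of_type P E 1 1 2 T \<or>
    triangle_of_type P E 2 2 3 T \<or> triangle_of_type P E 3 3 1 T}"

lemma finite_V: "finite V" and edge_subset: "E \<subseteq> nsets V 2"
  using graph by (auto simp: simple_graph_def)

lemma P_subset: "P i \<subseteq> V" and V_eq: "V = (\<Union>i. P i)" and disjoint: "i \<noteq> j \<Longrightarrow> P i \<inter> P j = {}"
  using part by (auto simp: tripartition_def disjoint_family_on_def)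

lemma finite_P [simp]: "finite (P i)"
  using finite_subset[OF P_subset finite_V] .

lemma adj_sym: "adj a b \<Longrightarrow> adj b a" and adj_irrefl [simp]: "\<not> adj a a"
  using edge_subset by (auto simp: adj_def insert_commute nsets_def)

lemma finite_index [simp]: "finite index" and finite_samples [simp]: "finite samples"
  by (auto simp: index_def samples_def intro!: finite_PiE)

lemma card_samples_pos: "0 < card samples"
proof -
  have "samples \<noteq> {}"
    using nonempty by (simp add: samples_def PiE_eq_empty_iff)
  then show ?thesis by (simp add: card_gt_0_iff)
qed

lemma sum_V: "sum f V = (\<Sum>i\<in>UNIV. sum f (P i))" for f :: "'a \<Rightarrow> real"
  unfolding V_eq using disjoint by (intro sum.UNION_disjoint) auto

lemma sum_index: "sum f index = (\<Sum>i\<in>UNIV. \<Sum>j<m. f (i, j))" for f :: "3 \<times> nat \<Rightarrow> real"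
  unfolding index_def by (simp add: sum.cartesian_product)

lemma vertex_degree_eq: "real (vertex_degree E v) = (\<Sum>w\<in>V. of_bool (adj v w))"
proof -
  have "bij_betw (\<lambda>w. {v, w}) {w\<in>V. adj v w} {e\<in>E. v \<in> e}"
  proof (rule bij_betw_imageI)
    show "inj_on (\<lambda>w. {v, w}) {w\<in>V. adj v w}"
      by (auto simp: inj_on_def doubleton_eq_iff)
    show "(\<lambda>w. {v, w}) ` {w\<in>V. adj v w} = {e\<in>E. v \<in> e}"
    proof (intro equalityI subsetI)
      fix e assume "e \<in> {e\<in>E. v \<in> e}"
      then have e: "e \<in> E" "v \<in> e" "e \<subseteq> V" "card e = 2"
        using edge_subset by (auto simp: nsets_def)
      then obtain w where "e = {v, w}" "w \<noteq> v"
        by (auto simp: card_2_iff)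
      with e show "e \<in> (\<lambda>w. {v, w}) ` {w\<in>V. adj v w}"
        by (auto simp: adj_def)
    qed (auto simp: adj_def)
  qed
  then have "vertex_degree E v = card {w\<in>V. adj v w}"
    unfolding vertex_degree_def by (simp add: bij_betw_same_card)
  then show ?thesis
    using finite_V by (simp add: sum.If_cases of_bool_def Int_def)
qed

lemma l2_norm_eq: "real (l2_norm V E) = (\<Sum>i\<in>UNIV. \<Sum>j\<in>UNIV. \<Sum>k\<in>UNIV. cherries i j k)"
proof -
  have "real (l2_norm V E) = (\<Sum>a\<in>V. \<Sum>b\<in>V. \<Sum>c\<in>V. of_bool (adj a b \<and> adj a c))"
    unfolding l2_norm_def by (simp add: vertex_degree_eq power2_eq_square sum_product of_bool_conj)
  also have "\<dots> = (\<Sum>i\<in>UNIV. \<Sum>a\<in>P i. \<Sum>j\<in>UNIV. \<Sum>b\<in>P j. \<Sum>k\<in>UNIV. \<Sum>c\<in>P k. of_bool (adj a b \<and> adj a c))"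
    unfolding sum_V ..
  also have "\<dots> = (\<Sum>i\<in>UNIV. \<Sum>j\<in>UNIV. \<Sum>a\<in>P i. \<Sum>k\<in>UNIV. \<Sum>b\<in>P j. \<Sum>c\<in>P k. of_bool (adj a b \<and> adj a c))"
    by (intro sum.cong refl) (subst sum.swap, intro sum.cong refl sum.swap)
  also have "\<dots> = (\<Sum>i\<in>UNIV. \<Sum>j\<in>UNIV. \<Sum>k\<in>UNIV. cherries i j k)"
    unfolding cherries_def by (intro sum.cong refl sum.swap)
  finally show ?thesis .
qed

lemma sample_norm_eq:
  "sample_norm f = (\<Sum>u\<in>index. \<Sum>v\<in>index. \<Sum>w\<in>index. of_bool (adj (f u) (f v) \<and> adj (f u) (f w))) / real m ^ 3"
proof -
  define D where "D u = (\<Sum>w\<in>index. of_bool (adj (f u) (f w)) :: real)" for u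
  have sq: "(\<Sum>v\<in>index. \<Sum>w\<in>index. of_bool (adj (f u) (f v) \<and> adj (f u) (f w))) = (D u)\<^sup>2" for u
    unfolding D_def power2_eq_square sum_product of_bool_conj ..
  have wd: "wdeg (\<lambda>_. 1 / real m) (\<lambda>u v. adj (f u) (f v)) index u = D u / real m" for u
    unfolding wdeg_def D_def sum_divide_distrib by simp
  show ?thesis
    unfolding sample_norm_def wnorm_def wd sq
    by (simp add: sum_divide_distrib power_divide power2_eq_square power3_eq_cube mult.assoc)
qed

lemma sum_samples:
  fixes G :: "'a \<Rightarrow> 'a \<Rightarrow> 'a \<Rightarrow> real"
  assumes "u \<in> index" "v \<in> index" "w \<in> index" "u \<noteq> v" "u \<noteq> w" "v \<noteq> w"
  shows "(\<Sum>f\<in>samples. G (f u) (f v) (f w))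
      * (real (card (P (fst u))) * real (card (P (fst v))) * real (card (P (fst w))))
    = (\<Sum>a\<in>P (fst u). \<Sum>b\<in>P (fst v). \<Sum>c\<in>P (fst w). G a b c) * real (card samples)"
  using sum_PiE_three[OF finite_index assms, of G "\<lambda>u. P (fst u)"] by (simp add: samples_def)

text \<open>Only index triples with pairwise distinct second components are kept. They consist of
  distinct indices even within one part, so \<open>sum_samples\<close> gives their exact average;
  the discarded share is at most \<open>3 / m\<close>.\<close>

lemma sum_sample_norm_ge:
  assumes M: "\<And>i. real (card (P i)) \<le> M"
  shows "(1 - 3 / real m) * real (l2_norm V E) * real (card samples) \<le> (\<Sum>f\<in>samples. sample_norm f) * M ^ 3"
proof -
  define h where "h u v w = (\<Sum>f\<in>samples. of_bool (adj (f u) (f v) \<and> adj (f u) (f w)) :: real)" for u v w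
  have cherries_nonneg: "0 \<le> cherries i j k" for i j k
    unfolding cherries_def by (intro sum_nonneg) simp
  have h_ge: "of_bool (a \<noteq> b \<and> a \<noteq> c \<and> b \<noteq> c) * (cherries i j k * real (card samples)) \<le> h (i, a) (j, b) (k, c) * M ^ 3"
    if "a < m" "b < m" "c < m" for i j k a b c
  proof (cases "a \<noteq> b \<and> a \<noteq> c \<and> b \<noteq> c")
    case True
    have "cherries i j k * real (card samples)
        = h (i, a) (j, b) (k, c) * (real (card (P i)) * real (card (P j)) * real (card (P k)))"
      using sum_samples[of "(i, a)" "(j, b)" "(k, c)" "\<lambda>x y z. of_bool (adj x y \<and> adj x z)"] that True
      by (simp add: h_def cherries_def index_def)
    also have "\<dots> \<le> h (i, a) (j, b) (k, c) * (M * M * M)"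
      using M order_trans[OF of_nat_0_le_iff M] unfolding h_def
      by (intro mult_left_mono mult_mono sum_nonneg) auto
    finally show ?thesis
      using True by (simp add: power3_eq_cube)
  next
    case False
    have "0 \<le> M" using M[of 1] by linarith
    then show ?thesis
      using False by (auto simp: h_def intro!: mult_nonneg_nonneg sum_nonneg)
  qed
  have "(real m ^ 3 - 3 * real m ^ 2) * (real (l2_norm V E) * real (card samples))
      \<le> (\<Sum>a<m. \<Sum>b<m. \<Sum>c<m. of_bool (a \<noteq> b \<and> a \<noteq> c \<and> b \<noteq> c)) * (real (l2_norm V E) * real (card samples))"
    by (intro mult_right_mono distinct_triples) auto
  also have "\<dots> = (\<Sum>i\<in>UNIV. \<Sum>j\<in>UNIV. \<Sum>k\<in>UNIV. \<Sum>a<m. \<Sum>b<m. \<Sum>c<m.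
      of_bool (a \<noteq> b \<and> a \<noteq> c \<and> b \<noteq> c) * (cherries i j k * real (card samples)))"
    unfolding l2_norm_eq by (simp only: sum_distrib_left sum_distrib_right)
  also have "\<dots> \<le> (\<Sum>i\<in>UNIV. \<Sum>j\<in>UNIV. \<Sum>k\<in>UNIV. \<Sum>a<m. \<Sum>b<m. \<Sum>c<m. h (i, a) (j, b) (k, c) * M ^ 3)"
    by (intro sum_mono h_ge) auto
  also have "\<dots> = (\<Sum>i\<in>UNIV. \<Sum>j\<in>UNIV. \<Sum>a<m. \<Sum>b<m. \<Sum>k\<in>UNIV. \<Sum>c<m. h (i, a) (j, b) (k, c) * M ^ 3)"
    by (intro sum.cong refl) (subst sum.swap, intro sum.cong refl sum.swap)
  also have "\<dots> = (\<Sum>u\<in>index. \<Sum>v\<in>index. \<Sum>w\<in>index. h u v w * M ^ 3)"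
    unfolding sum_index by (intro sum.cong refl sum.swap)
  also have "\<dots> = (\<Sum>f\<in>samples. \<Sum>u\<in>index. \<Sum>v\<in>index. \<Sum>w\<in>index.
      of_bool (adj (f u) (f v) \<and> adj (f u) (f w))) * M ^ 3"
    unfolding h_def sum_distrib_right[symmetric]
    by (simp only: sum.swap[where A = samples])
  also have "\<dots> = (\<Sum>f\<in>samples. sample_norm f) * M ^ 3 * real m ^ 3"
    using m by (simp add: sample_norm_eq sum_divide_distrib[symmetric])
  also have "real m ^ 3 - 3 * real m ^ 2 = (1 - 3 / real m) * real m ^ 3"
    using m by (simp add: field_simps power3_eq_cube power2_eq_square)
  finally have "(1 - 3 / real m) * real (l2_norm V E) * real (card samples) * real m ^ 3
      \<le> (\<Sum>f\<in>samples. sample_norm f) * M ^ 3 * real m ^ 3"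
    by (simp only: mult_ac)
  then show ?thesis
    using m by (simp only: mult_le_cancel_right_pos zero_less_power of_nat_0_less_iff)
qed

lemma sample_norm_le_27: "sample_norm f \<le> 27"
proof -
  have "wdeg (\<lambda>_. 1 / real m) (\<lambda>u v. adj (f u) (f v)) index u \<le> 3" for u
  proof -
    have "wdeg (\<lambda>_. 1 / real m) (\<lambda>u v. adj (f u) (f v)) index u \<le> (\<Sum>v\<in>index. 1 / real m)"
      unfolding wdeg_def by (intro sum_mono) auto
    also have "\<dots> = 3"
      using m by (simp add: index_def card_cartesian_product)
    finally show ?thesis .
  qed
  moreover have "0 \<le> wdeg (\<lambda>_. 1 / real m) (\<lambda>u v. adj (f u) (f v)) index u" for u
    unfolding wdeg_def by (intro sum_nonneg) auto
  ultimately have "sample_norm f \<le> (\<Sum>u\<in>index. 1 / real m * 3^2)"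
    unfolding sample_norm_def wnorm_def by (intro sum_mono mult_left_mono power_mono) auto
  also have "\<dots> = 27"
    using m by (simp add: index_def card_cartesian_product)
  finally show ?thesis .
qed

definition bad_count :: "(3 \<times> nat \<Rightarrow> 'a) \<Rightarrow> real" where
  "bad_count f = (\<Sum>(i, j, k)\<in>bad_types. \<Sum>a<m. \<Sum>b<m. \<Sum>c<m.
     of_bool (adj (f (i, a)) (f (j, b)) \<and> adj (f (j, b)) (f (k, c)) \<and> adj (f (i, a)) (f (k, c))))"

lemma finite_bad_types [simp]: "finite bad_types"
  by (simp add: bad_types_def)

lemma bad_count_nonneg: "0 \<le> bad_count f"
  unfolding bad_count_def by (auto intro!: sum_nonneg)

text \<open>An admissible sample falls under \<open>wnorm_le_9\<close>. Otherwise
  \<open>bad_count f\<close> is at least \<open>1\<close>, and \<open>27 = 9 + 18\<close> is the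
  trivial bound from total weight \<open>3\<close> and degrees at most \<open>3\<close>.\<close>

lemma sample_norm_le: "sample_norm f \<le> 9 + 18 * bad_count f"
proof (cases "admissible fst (\<lambda>u v. adj (f u) (f v)) index")
  case True
  have "sum (\<lambda>_. 1 / real m) {v\<in>index. fst v = i} = 1" for i :: 3
  proof -
    have "{v\<in>index. fst v = i} = {i} \<times> {..<m}" by (auto simp: index_def)
    then show ?thesis using m by (simp add: card_cartesian_product)
  qed
  then have "sample_norm f \<le> 9"
    unfolding sample_norm_def using True by (intro wnorm_le_9) auto
  then show ?thesis using bad_count_nonneg[of f] by simp
next
  case False
  then obtain u v w where uvw: "u \<in> index" "v \<in> index" "w \<in> index" "(fst u, fst v, fst w) \<in> bad_types"
    "adj (f u) (f v)" "adj (f v) (f w)" "adj (f u) (f w)"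
    unfolding admissible_def using adj_sym by fastforce
  obtain i a j b k c where e: "u = (i, a)" "v = (j, b)" "w = (k, c)"
    by (metis prod.exhaust)
  let ?t = "\<lambda>i j k a b c. of_bool (adj (f (i, a)) (f (j, b)) \<and> adj (f (j, b)) (f (k, c)) \<and> adj (f (i, a)) (f (k, c))) :: real"
  have "1 = ?t i j k a b c"
    using uvw e by simp
  also have "\<dots> \<le> (\<Sum>c<m. ?t i j k a b c)"
    using uvw(3) e by (intro member_le_sum) (auto simp: index_def)
  also have "\<dots> \<le> (\<Sum>b<m. \<Sum>c<m. ?t i j k a b c)"
    using uvw(2) e by (intro member_le_sum[of b]) (auto simp: index_def intro!: sum_nonneg)
  also have "\<dots> \<le> (\<Sum>a<m. \<Sum>b<m. \<Sum>c<m. ?t i j k a b c)"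
    using uvw(1) e by (intro member_le_sum[of a]) (auto simp: index_def intro!: sum_nonneg)
  also have "\<dots> = (\<lambda>(i, j, k). \<Sum>a<m. \<Sum>b<m. \<Sum>c<m. ?t i j k a b c) (i, j, k)"
    by simp
  also have "\<dots> \<le> bad_count f"
    unfolding bad_count_def using uvw(4) e
    by (intro member_le_sum[of "(i, j, k)"]) (auto intro!: sum_nonneg)
  finally show ?thesis
    using sample_norm_le_27[of f] by linarith
qed

text \<open>Each counted triple lies in \<open>T \<times> T \<times> T\<close> for its vertex set
  \<open>T\<close>, a bad set, and this product has \<open>27\<close> elements.\<close>

lemma triangles_le:
  assumes "(i, j, k) \<in> bad_types"
  shows "triangles i j k \<le> 27 * real (card bad_sets)"
proof -
  let ?X = "{(a, b, c)\<in>P i \<times> P j \<times> P k. adj a b \<and> adj b c \<and> adj a c}"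
  have "triangles i j k = (\<Sum>(a, b, c)\<in>P i \<times> P j \<times> P k. of_bool (adj a b \<and> adj b c \<and> adj a c))"
    unfolding triangles_def by (simp only: sum.cartesian_product)
  also have "\<dots> = (\<Sum>t\<in>?X. 1)"
    by (rule sum.mono_neutral_cong_right) (auto simp: of_bool_def split: if_splits)
  also have "\<dots> = real (card ?X)"
    by simp
  also have "card ?X \<le> card (\<Union>T\<in>bad_sets. T \<times> T \<times> T)"
  proof (rule card_mono)
    show "?X \<subseteq> (\<Union>T\<in>bad_sets. T \<times> T \<times> T)"
    proof clarify
      fix a b c assume abc: "a \<in> P i" "b \<in> P j" "c \<in> P k" "adj a b" "adj b c" "adj a c"
      then have ne: "a \<noteq> b" "b \<noteq> c" "a \<noteq> c" by auto
      have "nsets {a, b, c} 2 \<subseteq> E"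
      proof
        fix e assume "e \<in> nsets {a, b, c} 2"
        then have "e \<subseteq> {a, b, c}" "card e = 2" by (auto simp: nsets_def)
        then obtain x y where "e = {x, y}" "x \<noteq> y" "x \<in> {a, b, c}" "y \<in> {a, b, c}"
          by (auto simp: card_2_iff)
        then show "e \<in> E"
          using abc adj_sym[of a b] adj_sym[of b c] adj_sym[of a c] by (auto simp: adj_def)
      qed
      then have "triangle_of_type P E i j k {a, b, c}"
        unfolding triangle_of_type_def using abc ne by auto
      moreover have "{a, b, c} \<in> nsets V 3"
        using abc ne P_subset by (auto simp: nsets_def)
      ultimately have "{a, b, c} \<in> bad_sets"
        using assms by (auto simp: bad_sets_def bad_types_def)
      then show "(a, b, c) \<in> (\<Union>T\<in>bad_sets. T \<times> T \<times> T)" by blast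
    qed
    show "finite (\<Union>T\<in>bad_sets. T \<times> T \<times> T)"
      using finite_V by (auto simp: bad_sets_def nsets_def)
  qed
  also have "card (\<Union>T\<in>bad_sets. T \<times> T \<times> T) \<le> (\<Sum>T\<in>bad_sets. card (T \<times> T \<times> T))"
    using finite_V by (intro card_UN_le) (simp add: bad_sets_def finite_imp_finite_nsets)
  also have "\<dots> = (\<Sum>T\<in>bad_sets. 27)"
    by (intro sum.cong) (auto simp: bad_sets_def nsets_def card_cartesian_product)
  finally show ?thesis by simp
qed

text \<open>Index triples with a repetition contribute \<open>0\<close>, as \<open>adj\<close> is
  irreflexive; the others average to a triangle density. The constant is \<open>4\<close> types
  times the \<open>27\<close> of \<open>triangles_le\<close>.\<close>

lemma sum_bad_count_le:
  assumes M: "0 < M" "\<And>i. M \<le> real (card (P i))"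
  shows "(\<Sum>f\<in>samples. bad_count f) * M ^ 3 \<le> 108 * real m ^ 3 * real (card bad_sets) * real (card samples)"
proof -
  define h where "h u v w = (\<Sum>f\<in>samples. of_bool (adj (f u) (f v) \<and> adj (f v) (f w) \<and> adj (f u) (f w)) :: real)"
    for u v w
  have h_le: "h u v w * M ^ 3 \<le> 27 * real (card bad_sets) * real (card samples)"
    if uvw: "u \<in> index" "v \<in> index" "w \<in> index" "(fst u, fst v, fst w) \<in> bad_types" for u v w
  proof (cases "u \<noteq> v \<and> u \<noteq> w \<and> v \<noteq> w")
    case False
    then have "h u v w = 0" by (auto simp: h_def intro!: sum.neutral)
    then show ?thesis by simp
  next
    case True
    have "h u v w * M ^ 3
        \<le> h u v w * (real (card (P (fst u))) * real (card (P (fst v))) * real (card (P (fst w))))"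
      unfolding power3_eq_cube h_def using M
      by (intro mult_left_mono mult_mono sum_nonneg) auto
    also have "\<dots> = triangles (fst u) (fst v) (fst w) * real (card samples)"
      unfolding h_def triangles_def using uvw True by (intro sum_samples) auto
    also have "\<dots> \<le> 27 * real (card bad_sets) * real (card samples)"
      using triangles_le[OF uvw(4)] by (intro mult_right_mono) auto
    finally show ?thesis .
  qed
  have "(\<Sum>f\<in>samples. bad_count f) * M ^ 3
      = (\<Sum>(i, j, k)\<in>bad_types. \<Sum>a<m. \<Sum>b<m. \<Sum>c<m. h (i, a) (j, b) (k, c) * M ^ 3)"
    unfolding bad_count_def h_def sum_distrib_right[symmetric] case_prod_unfold
    by (simp only: sum.swap[where A = samples])
  also have "\<dots> \<le> (\<Sum>(i, j, k)\<in>bad_types. \<Sum>a<m. \<Sum>b<m. \<Sum>c<m. 27 * real (card bad_sets) * real (card samples))"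
    unfolding case_prod_unfold by (intro sum_mono h_le) (auto simp: index_def)
  also have "\<dots> = 4 * (real m ^ 3 * (27 * real (card bad_sets) * real (card samples)))"
    by (simp add: bad_types_def power3_eq_cube)
  finally show ?thesis by simp
qed

text \<open>With at least three vertices \<open>nsets V 3\<close> is nonempty, so
  \<open>rho3\<close> is a genuine quotient; its denominator is at most the cube of
  \<open>card V\<close>.\<close>

lemma card_bad_sets_le:
  assumes "rho3 V P E \<le> \<delta>" "3 \<le> card V" "0 \<le> \<delta>"
  shows "real (card bad_sets) \<le> \<delta> * real (card V) ^ 3"
proof -
  have card: "card (nsets V 3) = card V choose 3"
    using finite_V by simp
  then have pos: "0 < card (nsets V 3)"
    using assms(2) by (simp add: zero_less_binomial)
  then have "finite (nsets V 3)" "nsets V 3 \<noteq> {}"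
    using card_gt_0_iff by blast+
  then have "rho3 V P E = real (card bad_sets) / real (card (nsets V 3))"
    unfolding rho3_def bad_sets_def by (simp add: measure_pmf_of_set)
  then have "real (card bad_sets) \<le> \<delta> * real (card (nsets V 3))"
    using assms(1) pos by (simp add: field_simps)
  also have "\<dots> \<le> \<delta> * real (card V) ^ 3"
    using assms card binomial_le_pow[of 3 "card V"]
    by (intro mult_left_mono) (auto simp flip: of_nat_power)
  finally show ?thesis .
qed

text \<open>
  The constant is \<open>18 * 4 * 27 * 27\<close>: a sample with a bad triangle costs at most \<open>27 - 9\<close>, there are
  \<open>4\<close> types, at most \<open>3\<^sup>3\<close> ordered triples per bad set, and \<open>card V ^ 3 \<le> 27 * hi ^ 3\<close>.
\<close>

lemma l2_norm_le:
  assumes lo: "0 < lo" "\<And>i. lo \<le> real (card (P i))" and hi: "\<And>i. real (card (P i)) \<le> hi"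
    and \<delta>: "0 \<le> \<delta>" "rho3 V P E \<le> \<delta>"
  shows "(1 - 3 / real m) * real (l2_norm V E) \<le> (9 + 52488 * real m ^ 3 * \<delta> * (hi / lo) ^ 3) * hi ^ 3"
proof -
  define K where "K = real (card samples)"
  have K: "0 < K" using card_samples_pos by (simp add: K_def)
  have hi_pos: "0 < hi" using lo(1) lo(2)[of 1] hi[of 1] by linarith
  have card_V: "real (card V) = (\<Sum>i\<in>UNIV. real (card (P i)))"
    using sum_V[of "\<lambda>_. 1"] by simp
  have "real (card V) \<le> 3 * hi"
    using sum_mono[of UNIV "\<lambda>i. real (card (P i))" "\<lambda>_. hi"] hi unfolding card_V by simp
  moreover have "3 \<le> card V"
  proof -
    have "1 \<le> real (card (P i))" for i
      using nonempty[of i] by (simp add: Suc_le_eq card_gt_0_iff)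
    then have "3 \<le> real (card V)"
      using sum_mono[of UNIV "\<lambda>_. 1" "\<lambda>i. real (card (P i))"] unfolding card_V by simp
    then show ?thesis by simp
  qed
  ultimately have bad: "real (card bad_sets) \<le> \<delta> * (3 * hi) ^ 3"
    using card_bad_sets_le[OF \<delta>(2) _ \<delta>(1)] \<delta>(1)
    by (meson mult_left_mono order_trans power_mono of_nat_0_le_iff)
  have "(\<Sum>f\<in>samples. bad_count f) * lo ^ 3 \<le> 108 * real m ^ 3 * real (card bad_sets) * K"
    unfolding K_def by (rule sum_bad_count_le[OF lo])
  also have "\<dots> \<le> 108 * real m ^ 3 * (\<delta> * (3 * hi) ^ 3) * K"
    using bad K by (intro mult_right_mono mult_left_mono) auto
  finally have "(\<Sum>f\<in>samples. bad_count f) \<le> 108 * real m ^ 3 * (\<delta> * (3 * hi) ^ 3) * K / lo ^ 3"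
    using lo(1) by (simp add: pos_le_divide_eq)
  also have "\<dots> = 2916 * real m ^ 3 * \<delta> * (hi / lo) ^ 3 * K"
    by (simp add: power_mult_distrib power_divide)
  finally have bad_avg: "(\<Sum>f\<in>samples. bad_count f) \<le> 2916 * real m ^ 3 * \<delta> * (hi / lo) ^ 3 * K" .
  have "(\<Sum>f\<in>samples. sample_norm f) \<le> (\<Sum>f\<in>samples. 9 + 18 * bad_count f)"
    by (intro sum_mono sample_norm_le)
  also have "\<dots> = 9 * K + 18 * (\<Sum>f\<in>samples. bad_count f)"
    by (simp add: sum.distrib sum_distrib_left K_def)
  also have "\<dots> \<le> (9 + 52488 * real m ^ 3 * \<delta> * (hi / lo) ^ 3) * K"
    using bad_avg by (simp add: algebra_simps)
  finally have "(\<Sum>f\<in>samples. sample_norm f) * hi ^ 3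
      \<le> (9 + 52488 * real m ^ 3 * \<delta> * (hi / lo) ^ 3) * K * hi ^ 3"
    using hi_pos by (intro mult_right_mono) auto
  then have "((1 - 3 / real m) * real (l2_norm V E)) * K
      \<le> ((9 + 52488 * real m ^ 3 * \<delta> * (hi / lo) ^ 3) * hi ^ 3) * K"
    using sum_sample_norm_ge[OF hi] unfolding K_def by (simp only: mult_ac)
  then show ?thesis
    using K by (simp only: mult_le_cancel_right_pos)
qed

end

section \<open>Choice of the constants\<close>

theorem theorem2p3:
  shows "\<forall>\<epsilon>::real. \<epsilon> > 0 \<longrightarrow> (\<exists>\<delta>::real. \<delta> > 0 \<and> (\<exists>N::nat. \<forall>n\<ge>N.
    \<forall>(V::'a set) (E::'a set set) (P::3 \<Rightarrow> 'a set).
      simple_graph V E \<longrightarrow> tripartition V P \<longrightarrow> locally_maximal P E \<longrightarrow>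
      (MAX i. \<bar>real (card (P i)) - real n\<bar>) \<le> \<delta> * real n \<longrightarrow>
      rho3 V P E \<le> \<delta> \<longrightarrow>
      real (l2_norm V E) \<le> 9 * real n ^ 3 + \<epsilon> * real n ^ 3))"
proof (intro allI impI)
  fix \<epsilon> :: real assume \<epsilon>: "\<epsilon> > 0"
  \<comment> \<open>The sample size is fixed first, so large that the loss factor
    \<open>1 - 3 / m\<close> is absorbed by \<open>\<epsilon>\<close>.\<close>
  obtain m :: nat where m_gt: "3 < m" "9 < (9 + \<epsilon>) * (1 - 3 / real m)"
  proof -
    have "((\<lambda>m. (9 + \<epsilon>) * (1 - 3 / real m)) \<longlongrightarrow> (9 + \<epsilon>) * (1 - 0)) sequentially"
      by (intro tendsto_intros lim_const_over_n)
    then have "\<forall>\<^sub>F m in sequentially. 9 < (9 + \<epsilon>) * (1 - 3 / real m)"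
      using \<epsilon> by (intro order_tendstoD(1)) auto
    then have "\<forall>\<^sub>F m in sequentially. 3 < m \<and> 9 < (9 + \<epsilon>) * (1 - 3 / real m)"
      using eventually_gt_at_top[of 3] by eventually_elim auto
    then show thesis
      using that eventually_happens'[OF sequentially_bot] by blast
  qed
  \<comment> \<open>\<open>F \<delta>\<close> is the bound of \<open>l2_norm_le\<close> for part
    sizes between \<open>(1 - \<delta>) * n\<close> and \<open>(1 + \<delta>) * n\<close>, divided
    by \<open>n^3\<close>; for fixed \<open>m\<close> it tends to \<open>9\<close>.\<close>
  define F where "F \<delta> = (9 + 52488 * real m ^ 3 * \<delta> * ((1 + \<delta>) / (1 - \<delta>)) ^ 3) * (1 + \<delta>) ^ 3" for \<delta> :: real
  have "(F \<longlongrightarrow> (9 + 52488 * real m ^ 3 * 0 * ((1 + 0) / (1 - 0)) ^ 3) * (1 + 0) ^ 3) (at_right 0)"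
    unfolding F_def by (intro tendsto_intros) auto
  then have "\<forall>\<^sub>F \<delta> in at_right 0. F \<delta> < (9 + \<epsilon>) * (1 - 3 / real m)"
    using m_gt(2) by (intro order_tendstoD(2)) auto
  moreover have "\<forall>\<^sub>F \<delta> in at_right 0. \<delta> < (1::real)"
    by (intro order_tendstoD(2)[OF tendsto_ident_at]) auto
  moreover have "\<forall>\<^sub>F \<delta> in at_right 0. (0::real) < \<delta>"
    by (simp add: eventually_at_right_less)
  ultimately have "\<forall>\<^sub>F \<delta> in at_right 0. 0 < \<delta> \<and> \<delta> < (1::real) \<and> F \<delta> < (9 + \<epsilon>) * (1 - 3 / real m)"
    by eventually_elim auto
  then obtain \<delta> where \<delta>: "0 < \<delta>" "\<delta> < 1" "F \<delta> < (9 + \<epsilon>) * (1 - 3 / real m)"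
    by (auto dest: eventually_happens)
  have "real (l2_norm V E) \<le> 9 * real n ^ 3 + \<epsilon> * real n ^ 3"
    if n: "1 \<le> n" and G: "simple_graph V E" and T: "tripartition V P"
      and sizes: "(MAX i. \<bar>real (card (P i)) - real n\<bar>) \<le> \<delta> * real n" and rho: "rho3 V P E \<le> \<delta>"
    for n and V :: "'a set" and E and P :: "3 \<Rightarrow> 'a set"
  proof -
    have "\<bar>real (card (P i)) - real n\<bar> \<le> \<delta> * real n" for i
      using order_trans[OF Max_ge sizes] by auto
    then have size: "(1 - \<delta>) * real n \<le> real (card (P i))" "real (card (P i)) \<le> (1 + \<delta>) * real n" for i
      by (auto simp: abs_le_iff algebra_simps)
    \<comment> \<open>Since \<open>\<delta> < 1\<close>, already \<open>n \<ge> 1\<close> makes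
      every part nonempty, so \<open>N = 1\<close> suffices.\<close>
    have lo: "0 < (1 - \<delta>) * real n"
      using n \<delta> by simp
    have "P i \<noteq> {}" for i
      using size(1)[of i] lo by auto
    then interpret sampling V E P m
      using G T m_gt(1) by unfold_locales auto
    have "(1 - 3 / real m) * real (l2_norm V E)
        \<le> (9 + 52488 * real m ^ 3 * \<delta> * (((1 + \<delta>) * real n) / ((1 - \<delta>) * real n)) ^ 3) * ((1 + \<delta>) * real n) ^ 3"
      using lo size \<delta>(1) rho by (intro l2_norm_le) auto
    also have "\<dots> = F \<delta> * real n ^ 3"
      using n unfolding F_def by (simp add: power_mult_distrib)
    also have "\<dots> \<le> (9 + \<epsilon>) * (1 - 3 / real m) * real n ^ 3"
      using \<delta>(3) by (intro mult_right_mono) auto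
    finally have "(1 - 3 / real m) * real (l2_norm V E) \<le> (1 - 3 / real m) * ((9 + \<epsilon>) * real n ^ 3)"
      by (simp only: mult_ac)
    moreover have "0 < 1 - 3 / real m"
      using m_gt(1) by simp
    ultimately have "real (l2_norm V E) \<le> (9 + \<epsilon>) * real n ^ 3"
      by (simp only: mult_le_cancel_left_pos)
    then show ?thesis by (simp add: algebra_simps)
  qed
  then show "\<exists>\<delta>::real. \<delta> > 0 \<and> (\<exists>N::nat. \<forall>n\<ge>N.
    \<forall>(V::'a set) (E::'a set set) (P::3 \<Rightarrow> 'a set).
      simple_graph V E \<longrightarrow> tripartition V P \<longrightarrow> locally_maximal P E \<longrightarrow>
      (MAX i. \<bar>real (card (P i)) - real n\<bar>) \<le> \<delta> * real n \<longrightarrow>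
      rho3 V P E \<le> \<delta> \<longrightarrow>
      real (l2_norm V E) \<le> 9 * real n ^ 3 + \<epsilon> * real n ^ 3)"
    using \<delta>(1) by blast
qed

end
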